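(* The algebra $\tilde{\mathcal{A}}_{conv.}$ is left and right noetherian. Moreover, every normal left ideal and every normal right ideal of $\tilde{\mathcal{A}}_{conv.}$ is principal.
   Context: Let $\mathcal{A}_0$ be the $\mathbb{C}$-algebra of polynomials in $a,b$ subject to $ab-ba=b^2$, and $\widehat{\mathcal{A}}$ its completion for the $(a,b)$-adic topology (formal power series $\sum_{p,q\ge0}\gamma_{p,q}a^pb^q$). $\tilde{\mathcal{A}}_{conv.}\subset\widehat{\mathcal{A}}$ is the subalgebra of series for which there exist $R>1$, $C_R>0$ with $|\gamma_{p,q}|\le C_RR^{p+q}q!$ for all $p,q$. A left ideal $I\subset\tilde{\mathcal{A}}_{conv.}$ is called normal if $bx\in I$ implies $x\in I$; a right ideal $I$ is called normal if $xb\in I$ implies $x\in I$. *)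

theory Defs
  imports Complex_Main
begin

text \<open>A formal series \<open>\<Sum>_{p,q} \<gamma> p q a^p b^q\<close> in normally ordered monomials of the
  algebra \<open>ab - ba = b^2\<close> is represented by its coefficient function.\<close>

type_synonym jseries = "nat \<Rightarrow> nat \<Rightarrow> complex"

text \<open>\<open>nf q p s\<close> is the normally ordered form of the word \<open>b^q a^p b^s\<close>:
  its coefficient of \<open>a^m b^n\<close>.  It uses \<open>b^q a = a b^q - q b^(q+1)\<close>,
  which follows from \<open>ab - ba = b^2\<close>.\<close>
fun nf :: "nat \<Rightarrow> nat \<Rightarrow> nat \<Rightarrow> nat \<Rightarrow> nat \<Rightarrow> int" where
  "nf q 0 s = (\<lambda>m n. if m = 0 \<and> n = q + s then 1 else 0)"
| "nf q (Suc p) s = (\<lambda>m n. (if m = 0 then 0 else nf q p s (m - 1) n) - int q * nf (Suc q) p s m n)"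

text \<open>Structure constant: coefficient of \<open>a^m b^n\<close> in \<open>(a^p b^q)(a^p' b^q')\<close>.\<close>
definition struct_const :: "nat \<Rightarrow> nat \<Rightarrow> nat \<Rightarrow> nat \<Rightarrow> nat \<Rightarrow> nat \<Rightarrow> int" where
  "struct_const p q p' q' m n = (if p \<le> m then nf q p' q' (m - p) n else 0)"

text \<open>Product in the (a,b)-adic completion; the relation is homogeneous, so only
  monomials of total degree \<open>m+n\<close> contribute (a finite sum).\<close>
definition jmult :: "jseries \<Rightarrow> jseries \<Rightarrow> jseries" where
  "jmult f g = (\<lambda>m n. \<Sum>p\<le>m+n. \<Sum>q\<le>m+n. \<Sum>p'\<le>m+n. \<Sum>q'\<le>m+n.
      if p + q + p' + q' = m + n
      then f p q * g p' q' * of_int (struct_const p q p' q' m n) else 0)"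

definition jb :: jseries where
  "jb = (\<lambda>p q. if p = 0 \<and> q = 1 then 1 else 0)"

definition Aconv :: "jseries set" where
  "Aconv = {\<gamma>. \<exists>R>1. \<exists>C>0. \<forall>p q. norm (\<gamma> p q) \<le> C * R ^ (p + q) * fact q}"

definition add_subgroup :: "jseries set \<Rightarrow> bool" where
  "add_subgroup I \<longleftrightarrow> I \<subseteq> Aconv \<and> (\<lambda>p q. 0) \<in> I \<and>
    (\<forall>x\<in>I. \<forall>y\<in>I. (\<lambda>p q. x p q + y p q) \<in> I \<and> (\<lambda>p q. x p q - y p q) \<in> I)"

definition left_ideal :: "jseries set \<Rightarrow> bool" where
  "left_ideal I \<longleftrightarrow> add_subgroup I \<and> (\<forall>x\<in>Aconv. \<forall>y\<in>I. jmult x y \<in> I)"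

definition right_ideal :: "jseries set \<Rightarrow> bool" where
  "right_ideal I \<longleftrightarrow> add_subgroup I \<and> (\<forall>x\<in>Aconv. \<forall>y\<in>I. jmult y x \<in> I)"

definition left_noetherian :: bool where
  "left_noetherian \<longleftrightarrow> (\<forall>I :: nat \<Rightarrow> jseries set.
     (\<forall>n. left_ideal (I n)) \<and> (\<forall>n. I n \<subseteq> I (Suc n)) \<longrightarrow> (\<exists>N. \<forall>n\<ge>N. I n = I N))"

definition right_noetherian :: bool where
  "right_noetherian \<longleftrightarrow> (\<forall>I :: nat \<Rightarrow> jseries set.
     (\<forall>n. right_ideal (I n)) \<and> (\<forall>n. I n \<subseteq> I (Suc n)) \<longrightarrow> (\<exists>N. \<forall>n\<ge>N. I n = I N))"

definition normal_left_ideal :: "jseries set \<Rightarrow> bool" where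
  "normal_left_ideal I \<longleftrightarrow> left_ideal I \<and> (\<forall>x\<in>Aconv. jmult jb x \<in> I \<longrightarrow> x \<in> I)"

definition normal_right_ideal :: "jseries set \<Rightarrow> bool" where
  "normal_right_ideal I \<longleftrightarrow> right_ideal I \<and> (\<forall>x\<in>Aconv. jmult x jb \<in> I \<longrightarrow> x \<in> I)"

definition principal_left_ideal :: "jseries set \<Rightarrow> bool" where
  "principal_left_ideal I \<longleftrightarrow> (\<exists>g\<in>Aconv. I = {jmult x g | x. x \<in> Aconv})"

definition principal_right_ideal :: "jseries set \<Rightarrow> bool" where
  "principal_right_ideal I \<longleftrightarrow> (\<exists>g\<in>Aconv. I = {jmult g x | x. x \<in> Aconv})"

end

theory Submission
  imports Defs "HOL-Analysis.Analysis"
begin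

text \<open>
  Letting \<open>a\<close> act on powers \<open>z^t\<close> as multiplication by \<open>z\<close> and \<open>b\<close> as integration gives a
  faithful representation, in which identities between products can be checked; the
  anti-automorphism \<open>a \<mapsto> a\<close>, \<open>b \<mapsto> -b\<close> becomes \<open>t \<mapsto> -t-n-1\<close> in degree \<open>n\<close> and exchanges left
  and right ideals, so only right ideals matter.

  The heart is a Weierstrass division theorem: if \<open>g\<close> is \<open>a^k\<close> times a unit modulo \<open>b\<close>, every \<open>x\<close>
  is \<open>g u + r\<close> with \<open>r\<close> of degree less than \<open>k\<close> in \<open>a\<close>.  The quotient \<open>u\<close> is determined
  recursively; its convergence follows from a majorant \<open>q! / (\<rho>^p \<sigma>^q V(p,q))\<close>, where \<open>V\<close> is the
  incomplete beta integral of \<open>s^p (1-s)^q\<close> over \<open>[1/2, 1]\<close>.  Truncating the integral at \<open>1/2\<close> keeps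
  division by \<open>a^k\<close> bounded, while integration by parts still controls the commutation of \<open>b\<close>
  past powers of \<open>a\<close>.

  Order exponents first by the power of \<open>b\<close>, then by that of \<open>a\<close>.  A right ideal is determined
  within any larger one by the least leading exponent at each power of \<open>b\<close>, which gives the
  chain condition; in a normal ideal an element with minimal leading exponent generates.
\<close>

subsection \<open>The action on powers\<close>

text \<open>Moving \<open>b^q\<close> past one letter \<open>a\<close> either keeps the letter or
  trades it for one more \<open>b\<close>, at the price of minus the current exponent of
  \<open>b\<close>. The binomial counts which \<open>m\<close> of the \<open>p\<close> letters
  survive, and the prices \<open>q\<close>, \<open>q+1\<close>, ... multiply to the rising
  factorial; Pascal's rule closes the induction.\<close>

lemma nf_eq:
  "nf q p s m n = (if m \<le> p \<and> m + n = p + q + s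
     then (-1) ^ (p - m) * int (p choose m) * pochhammer (int q) (p - m) else 0)"
proof (induction p arbitrary: q m n)
  case 0
  then show ?case by auto
next
  case (Suc p)
  show ?case
  proof (cases "m \<le> Suc p \<and> m + n = Suc p + q + s")
    case False
    then show ?thesis by (cases m) (auto simp: Suc.IH)
  next
    case True
    consider "m = 0" | "m = Suc p" | m' where "m = Suc m'" "m' < p"
      using True by (cases m) (auto simp: le_less)
    then show ?thesis
    proof cases
      case 1
      then show ?thesis using True by (simp add: Suc.IH pochhammer_rec ac_simps)
    next
      case 2
      then show ?thesis using True by (simp add: Suc.IH)
    next
      case (3 m')
      then have d: "p - m' = Suc (p - Suc m')" by simp
      show ?thesis using True 3
        by (simp add: Suc.IH d pochhammer_rec[of "int q"] algebra_simps)
    qed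
  qed
qed

text \<open>Since \<open>b^n z^t = z^(t+n) / (t+1)_n\<close>, both sides are the coefficient of
  \<open>z^(t+N)\<close> in \<open>b^q a^p b^s z^t\<close>, computed after and before normal
  ordering. The induction step is the commutation relation read on powers:
  \<open>1/(y)_q - q/(y)_(q+1) = 1/(y+1)_q\<close> with \<open>y = t+s+p+1\<close>.\<close>

lemma nf_action:
  fixes t :: complex
  assumes "t \<notin> \<int>"
  shows "N = p + q + s \<Longrightarrow> (\<Sum>n\<le>N. of_int (nf q p s (N - n) n) / pochhammer (t + 1) n)
    = 1 / (pochhammer (t + 1) s * pochhammer (t + of_nat s + of_nat p + 1) q)"
proof (induction p arbitrary: q N)
  case 0
  have "(\<Sum>n\<le>N. of_int (nf q 0 s (N - n) n) / pochhammer (t + 1) n)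
    = (\<Sum>n\<le>N. if n = N then 1 / pochhammer (t + 1) N else 0)"
    by (intro sum.cong refl) (use 0 in auto)
  also have "\<dots> = 1 / pochhammer (t + 1) N" by simp
  also have "pochhammer (t + 1) N = pochhammer (t + 1) s * pochhammer (t + 1 + of_nat s) q"
    using pochhammer_product'[of "t + 1" s q] 0 by (simp add: add.commute)
  finally show ?case by (simp add: ac_simps)
next
  case (Suc p)
  define z where "z = t + of_nat s + of_nat p + 1"
  have nz: "z + of_nat i \<noteq> 0" for i
  proof
    assume "z + of_nat i = 0"
    then have "t = - (of_nat s + of_nat p + 1 + of_nat i)"
      unfolding z_def by (simp add: add_eq_0_iff algebra_simps)
    then have "t \<in> \<int>" by simp
    with assms show False by simp
  qed
  obtain N' where N: "N = Suc N'" "N' = p + q + s" using Suc.prems by auto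
  have 1: "(\<Sum>n\<le>N. of_int (if N - n = 0 then 0 else nf q p s (N - n - 1) n) / pochhammer (t + 1) n)
     = (\<Sum>n\<le>N'. of_int (nf q p s (N' - n) n) / pochhammer (t + 1) n)"
    unfolding N by (simp add: Suc_diff_le)
  have "(\<Sum>n\<le>N. of_int (nf q (Suc p) s (N - n) n) / pochhammer (t + 1) n)
    = (\<Sum>n\<le>N. of_int (if N - n = 0 then 0 else nf q p s (N - n - 1) n) / pochhammer (t + 1) n)
     - of_nat q * (\<Sum>n\<le>N. of_int (nf (Suc q) p s (N - n) n) / pochhammer (t + 1) n)"
    unfolding sum_distrib_left sum_subtractf[symmetric]
    by (intro sum.cong refl) (simp add: diff_divide_distrib)
  also have "\<dots> = 1 / (pochhammer (t + 1) s * pochhammer z q)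
      - of_nat q * (1 / (pochhammer (t + 1) s * pochhammer z (Suc q)))"
    unfolding 1 z_def using Suc.IH[of N' q] Suc.IH[of N "Suc q"] N by simp
  also have "\<dots> = 1 / (pochhammer (t + 1) s * pochhammer (z + 1) q)"
  proof -
    have pz: "pochhammer z q \<noteq> 0"
      using nz by (metis pochhammer_eq_0_iff add.left_inverse)
    have "pochhammer z (Suc q) = z * pochhammer (z + 1) q" by (rule pochhammer_rec)
    moreover have "pochhammer z (Suc q) = pochhammer z q * (z + of_nat q)" by (rule pochhammer_Suc)
    ultimately have e: "z * pochhammer (z + 1) q = pochhammer z q * (z + of_nat q)" by simp
    have "1 / pochhammer z q - of_nat q / (pochhammer z q * (z + of_nat q))
       = z / (pochhammer z q * (z + of_nat q))"
    proof -
      have "1 / pochhammer z q = (z + of_nat q) / (pochhammer z q * (z + of_nat q))"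
        using nz[of q] by simp
      then show ?thesis by (simp only: diff_divide_distrib[symmetric] add_diff_cancel_right')
    qed
    also have "\<dots> = 1 / pochhammer (z + 1) q" using nz[of 0] e[symmetric] by simp
    finally have "1 / pochhammer (t + 1) s * (1 / pochhammer z q - of_nat q / (pochhammer z q * (z + of_nat q)))
      = 1 / pochhammer (t + 1) s * (1 / pochhammer (z + 1) q)" by simp
    then show ?thesis by (simp add: pochhammer_Suc right_diff_distrib)
  qed
  finally show ?case by (simp add: z_def ac_simps)
qed

text \<open>\<open>symb x n t\<close> is the coefficient of \<open>z^(t+n)\<close> in \<open>x z^t\<close>.  It is used for \<open>t \<notin> \<int>\<close>, where no
  denominator vanishes and \<open>t \<mapsto> -t-n-1\<close> makes sense.\<close>
definition symb :: "jseries \<Rightarrow> nat \<Rightarrow> complex \<Rightarrow> complex" where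
  "symb x n t = (\<Sum>q\<le>n. x (n - q) q / pochhammer (t + 1) q)"

text \<open>Multiplication is composition of operators: the part of \<open>y\<close> of degree
  \<open>n-i\<close> moves \<open>z^t\<close> to \<open>z^(t+n-i)\<close>, and there the part of
  \<open>x\<close> of degree \<open>i\<close> acts.\<close>

lemma symb_jmult:
  assumes t: "t \<notin> \<int>"
  shows "symb (jmult x y) n t
    = (\<Sum>i\<le>n. symb x i (t + of_nat (n - i)) * symb y (n - i) t)"
proof -
  define A where "A = (\<lambda>(p, q, p', q'). x p q * y p' q' *
     (1 / (pochhammer (t + 1) q' * pochhammer (t + of_nat q' + of_nat p' + 1) q)))"
  define S where "S = {..n} \<times> {..n} \<times> {..n} \<times> {..n}"
  define S' where "S' = {(p, q, p', q'). p + q + p' + q' = n}"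
  have S': "{z \<in> S. case z of (p, q, p', q') \<Rightarrow> p + q + p' + q' = n} = S'"
    unfolding S_def S'_def by auto
  have act: "(\<Sum>k\<le>n. of_int (struct_const p q p' q' (n - k) k) / pochhammer (t + 1) k)
     = 1 / (pochhammer (t + 1) q' * pochhammer (t + of_nat q' + of_nat p' + 1) q)"
    if "p + q + p' + q' = n" for p q p' q'
  proof -
    have "(\<Sum>k\<le>n. of_int (struct_const p q p' q' (n - k) k) / pochhammer (t + 1) k)
      = (\<Sum>k\<le>n - p. of_int (nf q p' q' (n - p - k) k) / pochhammer (t + 1) k)"
      by (intro sum.mono_neutral_cong_right) (use that in \<open>auto simp: struct_const_def diff_commute\<close>)
    also have "\<dots> = 1 / (pochhammer (t + 1) q' * pochhammer (t + of_nat q' + of_nat p' + 1) q)"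
      by (rule nf_action[OF t]) (use that in simp)
    finally show ?thesis .
  qed
  have "symb (jmult x y) n t = (\<Sum>k\<le>n. \<Sum>z\<in>S. case z of (p, q, p', q') \<Rightarrow>
      if p + q + p' + q' = n
      then x p q * y p' q' * (of_int (struct_const p q p' q' (n - k) k) / pochhammer (t + 1) k) else 0)"
    unfolding symb_def jmult_def S_def
    by (intro sum.cong refl)
      (simp add: sum.cartesian_product sum_divide_distrib if_distrib cong: if_cong prod.case_cong,
       intro sum.cong refl, auto)
  also have "\<dots> = (\<Sum>z\<in>S. \<Sum>k\<le>n. case z of (p, q, p', q') \<Rightarrow>
      if p + q + p' + q' = n
      then x p q * y p' q' * (of_int (struct_const p q p' q' (n - k) k) / pochhammer (t + 1) k) else 0)"
    by (rule sum.swap)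
  also have "\<dots> = (\<Sum>z\<in>S. if case z of (p, q, p', q') \<Rightarrow> p + q + p' + q' = n then A z else 0)"
  proof (intro sum.cong refl)
    fix z assume "z \<in> S"
    obtain p q p' q' where z: "z = (p, q, p', q')" by (cases z)
    show "(\<Sum>k\<le>n. case z of (p, q, p', q') \<Rightarrow>
      if p + q + p' + q' = n
      then x p q * y p' q' * (of_int (struct_const p q p' q' (n - k) k) / pochhammer (t + 1) k) else 0)
      = (if case z of (p, q, p', q') \<Rightarrow> p + q + p' + q' = n then A z else 0)"
      unfolding z A_def prod.case
      by (cases "p + q + p' + q' = n")
        (simp_all only: simp_thms if_True if_False sum_distrib_left[symmetric] act sum.neutral_const)
  qed
  also have "\<dots> = sum A S'"
    unfolding S'[symmetric] by (subst sum.inter_filter) (auto simp: S_def)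
  \<comment> \<open>The quadruples are grouped by the degree \<open>i = p + q\<close> of the left
    factor.\<close>
  also have "\<dots> = (\<Sum>(i, q, q')\<in>(SIGMA i:{..n}. {..i} \<times> {..n - i}). A (i - q, q, n - i - q', q'))"
    by (rule sum.reindex_bij_witness[where i = "\<lambda>(i, q, q'). (i - q, q, n - i - q', q')"
          and j = "\<lambda>(p, q, p', q'). (p + q, q, q')"]) (auto simp: S'_def)
  also have "\<dots> = (\<Sum>i\<le>n. \<Sum>q\<le>i. \<Sum>q'\<le>n - i. A (i - q, q, n - i - q', q'))"
    by (simp add: sum.Sigma sum.cartesian_product case_prod_unfold)
  also have "\<dots> = (\<Sum>i\<le>n. symb x i (t + of_nat (n - i)) * symb y (n - i) t)"
    unfolding symb_def sum_product
  proof (intro sum.cong refl)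
    fix i q q' assume "q' \<in> {..n - i}"
    then have "(of_nat q' + of_nat (n - i - q') :: complex) = of_nat (n - i)"
      by (simp flip: of_nat_add)
    then have "t + of_nat q' + of_nat (n - i - q') + 1 = t + of_nat (n - i) + 1"
      by (simp add: add.assoc)
    then show "A (i - q, q, n - i - q', q') = x (i - q) q / pochhammer (t + of_nat (n - i) + 1) q *
        (y (n - i - q') q' / pochhammer (t + 1) q')"
      unfolding A_def prod.case by (simp only:) simp
  qed
  finally show ?thesis .
qed

text \<open>Multiplying by \<open>(t+1)_(n+1)\<close> turns the relation of length
  \<open>n+1\<close> into a polynomial in \<open>t\<close>. At \<open>t = -(n+1)\<close> every term
  but the last contains a zero factor, so the top coefficient vanishes and the induction hypothesis
  takes the rest.\<close>

lemma inverse_pochhammer_independent: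
  fixes c :: "nat \<Rightarrow> complex"
  assumes "\<And>t. t \<notin> \<int> \<Longrightarrow> (\<Sum>q\<le>n. c q / pochhammer (t + 1) q) = 0"
  shows "q \<le> n \<Longrightarrow> c q = 0"
  using assms
proof (induction n arbitrary: q)
  case 0
  have "\<i> \<notin> \<int>" by (auto elim!: Ints_cases simp: complex_eq_iff)
  with 0(2)[of \<i>] 0(1) show ?case by simp
next
  case (Suc n)
  have pnz: "pochhammer (t + 1) k \<noteq> 0" if "t \<notin> \<int>" for t :: complex and k
  proof
    assume "pochhammer (t + 1) k = 0"
    then obtain i :: nat where "t + 1 = - of_nat i" by (auto simp: pochhammer_eq_0_iff)
    then have "t = - of_nat i - 1" by (simp add: algebra_simps)
    then show False using that by simp
  qed
  define F where "F = (\<lambda>t::complex. \<Sum>q\<le>Suc n. c q * (\<Prod>i\<in>{q..<Suc n}. t + 1 + of_nat i))"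
  have F0: "F t = 0" if t: "t \<notin> \<int>" for t
  proof -
    have "c q * (\<Prod>i\<in>{q..<Suc n}. t + 1 + of_nat i)
        = pochhammer (t + 1) (Suc n) * (c q / pochhammer (t + 1) q)" if "q \<le> Suc n" for q
    proof -
      have "pochhammer (t + 1) (Suc n) = pochhammer (t + 1) q * (\<Prod>i\<in>{q..<Suc n}. t + 1 + of_nat i)"
        unfolding pochhammer_prod by (subst prod.atLeastLessThan_concat) (use that in auto)
      then show ?thesis using pnz[OF t, of q] by simp
    qed
    then have "F t = pochhammer (t + 1) (Suc n) * (\<Sum>q\<le>Suc n. c q / pochhammer (t + 1) q)"
      unfolding F_def sum_distrib_left by (intro sum.cong) auto
    then show ?thesis using Suc.prems(2)[OF t] by simp
  qed
  define z where "z = (- of_nat (Suc n) :: complex)"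
  have "F z = 0"
  proof -
    \<comment> \<open>The evaluation point is itself an integer, where the hypothesis says nothing;
      it is approached vertically through non-integers.\<close>
    define h where "h = (\<lambda>m. z + \<i> * of_real (inverse (of_nat (Suc m))))"
    have "h \<longlonglongrightarrow> z + \<i> * of_real 0"
      unfolding h_def by (intro tendsto_intros LIMSEQ_inverse_real_of_nat)
    then have "h \<longlonglongrightarrow> z" by simp
    moreover have "isCont F z" unfolding F_def by (intro continuous_intros)
    ultimately have "(\<lambda>m. F (h m)) \<longlonglongrightarrow> F z" by (rule isCont_tendsto_compose[rotated])
    moreover have "h m \<notin> \<int>" for m
      by (auto elim!: Ints_cases simp: h_def z_def complex_eq_iff)
    then have "F (h m) = 0" for m by (rule F0)
    ultimately show ?thesis by (simp add: LIMSEQ_const_iff)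
  qed
  moreover have "F z = c (Suc n)"
  proof -
    have "(\<Prod>i\<in>{q..<Suc n}. z + 1 + of_nat i) = 0" if "q \<le> n" for q
      by (rule prod_zero) (use that in \<open>auto simp: z_def intro!: bexI[of _ n]\<close>)
    then have "(\<Sum>q\<le>n. c q * (\<Prod>i\<in>{q..<Suc n}. z + 1 + of_nat i)) = 0"
      by (intro sum.neutral ballI) (metis atMost_iff mult_zero_right)
    then show ?thesis by (simp add: F_def)
  qed
  ultimately have c: "c (Suc n) = 0" by simp
  have "c q = 0" if "q \<le> n" for q
  proof (rule Suc.IH[OF that])
    fix t :: complex assume "t \<notin> \<int>"
    then show "(\<Sum>q\<le>n. c q / pochhammer (t + 1) q) = 0" using Suc.prems(2)[of t] c by simp
  qed
  with c Suc.prems(1) show ?case by (auto simp: le_Suc_eq)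
qed

text \<open>This is faithfulness of the action: in each degree the coefficients are recovered by
  linear independence, so identities between products may be verified on symbols.\<close>

lemma symb_inject:
  assumes "\<And>n t. t \<notin> \<int> \<Longrightarrow> symb x n t = symb y n t"
  shows "x = y"
proof (intro ext)
  fix p q
  define c where "c k = x (p + q - k) k - y (p + q - k) k" for k
  have "c q = 0"
  proof (rule inverse_pochhammer_independent[where n = "p + q"])
    fix t :: complex assume "t \<notin> \<int>"
    from assms[OF this, of "p + q"]
    show "(\<Sum>k\<le>p + q. c k / pochhammer (t + 1) k) = 0"
      by (simp add: c_def symb_def diff_divide_distrib sum_subtractf)
  qed simp
  then show "x p q = y p q" by (simp add: c_def)
qed

section \<open>Right multiplication by powers of \<open>b\<close>, the twist moving them to the
  left, and the anti-automorphism\<close>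

definition jshift :: "nat \<Rightarrow> jseries \<Rightarrow> jseries" where
  "jshift j x = (\<lambda>p q. if q < j then 0 else x p (q - j))"

definition junshift :: "nat \<Rightarrow> jseries \<Rightarrow> jseries" where
  "junshift j x = (\<lambda>p q. x p (q + j))"

text \<open>\<open>x b = b (jtwist x)\<close>\<close>
definition jtwist :: "jseries \<Rightarrow> jseries" where
  "jtwist x = (\<lambda>p q. x p q + (if q = 0 then 0 else of_nat (Suc p) * x (Suc p) (q - 1)))"

text \<open>The anti-automorphism \<open>a \<mapsto> a\<close>, \<open>b \<mapsto> -b\<close>: it sends \<open>a^p b^q\<close> to \<open>(-1)^q b^q a^p\<close>.\<close>
definition jrev :: "jseries \<Rightarrow> jseries" where
  "jrev x = (\<lambda>m n. \<Sum>q\<le>m + n. (-1) ^ q * x (m + n - q) q * of_int (nf q (m + n - q) 0 m n))"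

lemma not_Ints_add_of_nat: "(t :: complex) \<notin> \<int> \<Longrightarrow> t + of_nat n \<notin> \<int>"
  by (metis Ints_diff Ints_of_nat add_diff_cancel_right')

lemma not_Ints_add_1: "(t :: complex) \<notin> \<int> \<Longrightarrow> t + 1 \<notin> \<int>"
  using not_Ints_add_of_nat[of t 1] by simp

lemma symb_jshift:
  "symb (jshift 1 x) 0 t = 0"
  "symb (jshift 1 x) (Suc n) t = symb x n (t + 1) / (t + 1)"
proof -
  show "symb (jshift 1 x) 0 t = 0" by (simp add: symb_def jshift_def)
  have "symb (jshift 1 x) (Suc n) t = (\<Sum>q\<le>n. x (n - q) q / pochhammer (t + 1) (Suc q))"
    unfolding symb_def by (subst sum.atMost_Suc_shift) (simp add: jshift_def)
  then show "symb (jshift 1 x) (Suc n) t = symb x n (t + 1) / (t + 1)"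
    by (simp add: symb_def pochhammer_rec sum_divide_distrib mult.commute)
qed

text \<open>Compare \<open>x b\<close> and \<open>b (jtwist x)\<close> on \<open>z^t\<close>: the
  former divides by \<open>t+1\<close> and then applies \<open>x\<close> at exponent
  \<open>t+1\<close>, while the latter ends with a division by \<open>t+n+1\<close>.\<close>

lemma symb_jtwist:
  assumes t: "t \<notin> \<int>"
  shows "symb (jtwist x) n t = (t + of_nat n + 1) / (t + 1) * symb x n (t + 1)"
proof -
  have nz: "t + 1 \<noteq> 0" "t + 1 + of_nat q \<noteq> 0" for q
    using not_Ints_add_1[OF t] not_Ints_add_of_nat[OF not_Ints_add_1[OF t], of q] by force+
  have "symb (jtwist x) n t = symb x n t
      + (\<Sum>q\<le>n. (if q = 0 then 0 else of_nat (Suc (n - q)) * x (Suc (n - q)) (q - 1)) / pochhammer (t + 1) q)"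
    by (simp add: symb_def jtwist_def add_divide_distrib sum.distrib)
  also have "(\<Sum>q\<le>n. (if q = 0 then 0 else of_nat (Suc (n - q)) * x (Suc (n - q)) (q - 1)) / pochhammer (t + 1) q)
     = (\<Sum>q<n. of_nat (n - q) * x (n - q) q / pochhammer (t + 1) (Suc q))"
  proof (cases n)
    case (Suc m)
    then show ?thesis
      by (subst Suc, subst sum.atMost_Suc_shift)
        (simp add: Suc_diff_le lessThan_Suc_atMost del: sum.lessThan_Suc of_nat_Suc)
  qed simp
  also have "\<dots> = (\<Sum>q\<le>n. of_nat (n - q) * x (n - q) q / pochhammer (t + 1) (Suc q))"
    by (rule sum.mono_neutral_left) auto
  also have "symb x n t + \<dots> = (\<Sum>q\<le>n. (t + of_nat n + 1) / (t + 1) * (x (n - q) q / pochhammer (t + 1 + 1) q))"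
    unfolding symb_def sum.distrib[symmetric]
  proof (intro sum.cong refl)
    fix q assume "q \<in> {..n}"
    then have q: "of_nat (n - q) = (of_nat n - of_nat q :: complex)" by (simp add: of_nat_diff)
    have e: "pochhammer (t + 1) q * (t + 1 + of_nat q) = (t + 1) * pochhammer (t + 1 + 1) q"
      using pochhammer_Suc[of "t + 1" q] pochhammer_rec[of "t + 1" q] by simp
    have "x (n - q) q / pochhammer (t + 1) q
      = (t + 1 + of_nat q) * x (n - q) q / (pochhammer (t + 1) q * (t + 1 + of_nat q))"
      using nz(2)[of q] by simp
    then have "x (n - q) q / pochhammer (t + 1) q + of_nat (n - q) * x (n - q) q / pochhammer (t + 1) (Suc q)
      = ((t + 1 + of_nat q) * x (n - q) q + of_nat (n - q) * x (n - q) q) / (pochhammer (t + 1) q * (t + 1 + of_nat q))"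
      by (simp only: pochhammer_Suc add_divide_distrib)
    also have "(t + 1 + of_nat q) * x (n - q) q + of_nat (n - q) * x (n - q) q = (t + of_nat n + 1) * x (n - q) q"
      by (simp add: q algebra_simps)
    finally show "x (n - q) q / pochhammer (t + 1) q + of_nat (n - q) * x (n - q) q / pochhammer (t + 1) (Suc q)
      = (t + of_nat n + 1) / (t + 1) * (x (n - q) q / pochhammer (t + 1 + 1) q)"
      by (simp add: e)
  qed
  finally show ?thesis by (simp add: symb_def sum_distrib_left)
qed

lemma jmult_jshift_jtwist: "jmult (jshift 1 w) (jtwist u) = jshift 1 (jmult w u)"
proof (rule symb_inject)
  fix n and t :: complex assume t: "t \<notin> \<int>"
  show "symb (jmult (jshift 1 w) (jtwist u)) n t = symb (jshift 1 (jmult w u)) n t"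
  proof (cases n)
    case 0
    then show ?thesis by (simp add: symb_jmult[OF t] symb_jshift del: One_nat_def)
  next
    case (Suc m)
    have nz: "t + of_nat k + 1 \<noteq> 0" for k
      using not_Ints_add_1[OF not_Ints_add_of_nat[OF t, of k]] by force
    have "symb (jmult (jshift 1 w) (jtwist u)) n t
      = (\<Sum>i\<le>m. symb w i (t + of_nat (m - i) + 1) / (t + of_nat (m - i) + 1) *
          ((t + of_nat (m - i) + 1) / (t + 1) * symb u (m - i) (t + 1)))"
      unfolding symb_jmult[OF t] Suc
      by (subst sum.atMost_Suc_shift) (simp add: symb_jshift symb_jtwist[OF t] del: One_nat_def)
    also have "\<dots> = (\<Sum>i\<le>m. symb w i (t + 1 + of_nat (m - i)) * symb u (m - i) (t + 1)) / (t + 1)"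
      unfolding sum_divide_distrib by (intro sum.cong refl) (use nz in \<open>simp add: ac_simps del: of_nat_diff\<close>)
    also have "\<dots> = symb (jshift 1 (jmult w u)) n t"
      unfolding Suc symb_jshift symb_jmult[OF not_Ints_add_1[OF t]] ..
    finally show ?thesis .
  qed
qed

lemma jshift_Suc: "jshift (Suc j) x = jshift 1 (jshift j x)"
  by (auto simp: jshift_def fun_eq_iff)

text \<open>Moving \<open>b^j\<close> to the right past the twisted factor undoes the twist. Hence
  \<open>(w u) b^j\<close> is a right multiple of \<open>w b^j\<close>, so that division by
  \<open>w\<close> can be carried out inside a right ideal containing \<open>w b^j\<close>.\<close>

lemma jmult_jshift: "jmult (jshift j w) ((jtwist ^^ j) u) = jshift j (jmult w u)"
proof (induction j)
  case 0
  then show ?case by (simp add: jshift_def)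
next
  case (Suc j)
  then show ?case by (simp add: jshift_Suc[of j] jmult_jshift_jtwist del: One_nat_def)
qed

lemma symb_jb: "symb jb n t = (if n = 1 then 1 / (t + 1) else 0)"
proof -
  have "symb jb n t = (\<Sum>q\<le>n. if q = n then (if n = 1 then 1 / (t + 1) else 0) else 0)"
    unfolding symb_def jb_def by (intro sum.cong) auto
  then show ?thesis by simp
qed

lemma jmult_jb_right: "jmult x jb = jshift 1 x"
proof (rule symb_inject)
  fix n and t :: complex assume t: "t \<notin> \<int>"
  show "symb (jmult x jb) n t = symb (jshift 1 x) n t"
  proof (cases n)
    case 0
    then show ?thesis by (simp add: symb_jmult[OF t] symb_jshift symb_jb del: One_nat_def)
  next
    case (Suc m)
    have "symb (jmult x jb) n t = (\<Sum>i\<le>n. if i = m then symb x m (t + 1) / (t + 1) else 0)"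
      unfolding symb_jmult[OF t] by (intro sum.cong) (auto simp: symb_jb Suc)
    also have "\<dots> = symb x m (t + 1) / (t + 1)" by (simp add: Suc)
    finally show ?thesis by (simp add: Suc symb_jshift del: One_nat_def)
  qed
qed

text \<open>The image \<open>(-1)^q b^q a^p\<close> of a monomial acts on \<open>z^t\<close> by
  \<open>(-1)^q / (t+p+1)_q\<close>. With \<open>n = p+q\<close> the reflection formula gives
  \<open>(-t-n)_q = (-1)^q (t+p+1)_q\<close>, which is the denominator of \<open>a^p b^q\<close> at
  \<open>-t-n-1\<close>.\<close>

lemma symb_jrev:
  assumes t: "t \<notin> \<int>"
  shows "symb (jrev x) n t = symb x n (- t - of_nat n - 1)"
proof -
  have "symb (jrev x) n t = (\<Sum>k\<le>n. \<Sum>q\<le>n. (-1) ^ q * x (n - q) q *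
      (of_int (nf q (n - q) 0 (n - k) k) / pochhammer (t + 1) k))"
    unfolding symb_def jrev_def by (intro sum.cong) (auto simp: sum_divide_distrib)
  also have "\<dots> = (\<Sum>q\<le>n. (-1) ^ q * x (n - q) q *
     (\<Sum>k\<le>n. of_int (nf q (n - q) 0 (n - k) k) / pochhammer (t + 1) k))"
    unfolding sum_distrib_left by (rule sum.swap)
  also have "\<dots> = (\<Sum>q\<le>n. (-1) ^ q * x (n - q) q * (1 / pochhammer (t + of_nat (n - q) + 1) q))"
  proof (intro sum.cong refl)
    fix q assume "q \<in> {..n}"
    then have "n = (n - q) + q + 0" by simp
    from nf_action[OF t this] show "(-1) ^ q * x (n - q) q *
     (\<Sum>k\<le>n. of_int (nf q (n - q) 0 (n - k) k) / pochhammer (t + 1) k)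
      = (-1) ^ q * x (n - q) q * (1 / pochhammer (t + of_nat (n - q) + 1) q)" by simp
  qed
  also have "\<dots> = symb x n (- t - of_nat n - 1)"
    unfolding symb_def
  proof (intro sum.cong refl)
    fix q assume "q \<in> {..n}"
    then have "pochhammer (- t - of_nat n - 1 + 1) q = (-1) ^ q * pochhammer (t + of_nat (n - q) + 1) q"
      using pochhammer_minus[of "t + of_nat n" q] by (simp add: of_nat_diff algebra_simps)
    moreover have "(-1) ^ q * x (n - q) q * (1 / y) = x (n - q) q / ((-1) ^ q * y)" for y :: complex
      by (cases "even q") auto
    ultimately show "(-1) ^ q * x (n - q) q * (1 / pochhammer (t + of_nat (n - q) + 1) q)
        = x (n - q) q / pochhammer (- t - of_nat n - 1 + 1) q" by simp
  qed
  finally show ?thesis .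
qed

lemma not_Ints_reflect: "(t :: complex) \<notin> \<int> \<Longrightarrow> - t - of_nat n - 1 \<notin> \<int>"
proof
  assume t: "t \<notin> \<int>" and "- t - of_nat n - 1 \<in> \<int>"
  then have "- (- t - of_nat n - 1) - of_nat n - 1 \<in> \<int>" by (intro Ints_diff Ints_minus) auto
  with t show False by simp
qed

lemma jrev_jrev: "jrev (jrev x) = x"
  by (rule symb_inject) (simp add: symb_jrev not_Ints_reflect)

lemma jrev_jmult: "jrev (jmult x y) = jmult (jrev y) (jrev x)"
proof (rule symb_inject)
  fix n and t :: complex assume t: "t \<notin> \<int>"
  let ?t = "- t - of_nat n - 1"
  have "symb (jrev (jmult x y)) n t = (\<Sum>i\<le>n. symb x i (?t + of_nat (n - i)) * symb y (n - i) ?t)"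
    by (simp add: symb_jrev[OF t] symb_jmult not_Ints_reflect[OF t])
  \<comment> \<open>Reversing the summation lets each factor's shift be absorbed by the reflection
    in its own degree, and this exchanges the two factors.\<close>
  also have "\<dots> = (\<Sum>i\<le>n. symb x (n - i) (?t + of_nat i) * symb y i ?t)"
    by (rule sum.reindex_bij_witness[where i = "\<lambda>i. n - i" and j = "\<lambda>i. n - i"]) auto
  also have "\<dots> = (\<Sum>i\<le>n. symb (jrev y) i (t + of_nat (n - i)) * symb (jrev x) (n - i) t)"
    by (intro sum.cong refl)
      (auto simp: symb_jrev t not_Ints_add_of_nat of_nat_diff algebra_simps)
  finally show "symb (jrev (jmult x y)) n t = symb (jmult (jrev y) (jrev x)) n t"
    by (simp add: symb_jmult[OF t])
qed

lemma symb_uminus: "symb (\<lambda>p q. - x p q) n t = - symb x n t"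
  by (simp add: symb_def sum_negf)

lemma symb_zero: "symb (\<lambda>p q. 0) n t = 0"
  by (simp add: symb_def)

lemma jrev_add: "jrev (\<lambda>p q. x p q + y p q) = (\<lambda>p q. jrev x p q + jrev y p q)"
  by (simp add: jrev_def algebra_simps sum.distrib)

lemma jrev_diff: "jrev (\<lambda>p q. x p q - y p q) = (\<lambda>p q. jrev x p q - jrev y p q)"
  by (simp add: jrev_def algebra_simps sum_subtractf)

lemma jrev_zero: "jrev (\<lambda>p q. 0) = (\<lambda>p q. 0)"
  by (simp add: jrev_def)

text \<open>Because \<open>b\<close> goes to \<open>-b\<close>, cancelling \<open>b\<close> on the
  left corresponds to cancelling it on the right. This carries normality of left ideals over to
  right ideals.\<close>

lemma jrev_jmult_jb: "jrev (jmult x jb) = (\<lambda>p q. - jmult jb (jrev x) p q)"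
proof (rule symb_inject)
  fix n and t :: complex assume t: "t \<notin> \<int>"
  have "symb (jrev jb) i s = - symb jb i s" if s: "s \<notin> \<int>" for i s
  proof (cases "i = 1")
    case True
    have "1 / (- s - 2 + 1) = - (1 / (s + 1))"
      by (subst minus_divide_right) (simp add: algebra_simps)
    then show ?thesis using True by (simp add: symb_jrev[OF s] symb_jb)
  qed (simp add: symb_jrev[OF s] symb_jb)
  then have "symb (jrev jb) i (t + of_nat k) = - symb jb i (t + of_nat k)" for i k
    using not_Ints_add_of_nat[OF t] by blast
  then show "symb (jrev (jmult x jb)) n t = symb (\<lambda>p q. - jmult jb (jrev x) p q) n t"
    by (simp add: jrev_jmult symb_jmult[OF t] symb_uminus sum_negf del: of_nat_diff)
qed

subsection \<open>Weierstrass division\<close>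

text \<open>Here \<open>a^r b^m\<close> is the monomial taken from \<open>g\<close>, and
  \<open>j\<close> counts the letters \<open>a\<close> of \<open>u\<close> that turn into
  \<open>b\<close> when \<open>b^m\<close> passes them. The exponents of the monomial of
  \<open>u\<close> are then forced.\<close>

lemma jmult_expand:
  "jmult g u M N = (\<Sum>r\<le>M. \<Sum>m\<le>N. \<Sum>j\<le>N - m.
     g r m * u (M - r + j) (N - m - j) * ((-1) ^ j * of_nat (M - r + j choose j) * pochhammer (of_nat m) j))"
proof -
  let ?D = "M + N"
  define S where "S = {..?D} \<times> {..?D} \<times> {..?D} \<times> {..?D}"
  define f where "f = (\<lambda>(p, q, p', q'). if p + q + p' + q' = ?D
      then g p q * u p' q' * of_int (struct_const p q p' q' M N) else 0)"
  define h where "h = (\<lambda>(r, m, j).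
     g r m * u (M - r + j) (N - m - j) * ((-1) ^ j * of_nat (M - r + j choose j) * pochhammer (of_nat m) j))"
  define T where "T = {..M} \<times> (SIGMA m:{..N}. {..N - m})"
  \<comment> \<open>The inequalities say that \<open>a^M\<close> contains the \<open>a^p\<close> on
    the left and at most all letters \<open>a\<close> available; otherwise the structure constant is
    zero.\<close>
  define S0 where "S0 = {(p, q, p', q'). p + q + p' + q' = ?D \<and> p \<le> M \<and> M \<le> p + p'}"
  have "jmult g u M N = sum f S"
    unfolding jmult_def f_def S_def by (simp add: sum.cartesian_product)
  also have "\<dots> = sum f S0"
  proof (rule sum.mono_neutral_right)
    show "finite S" by (simp add: S_def)
    show "S0 \<subseteq> S" by (auto simp: S_def S0_def)
    show "\<forall>i\<in>S - S0. f i = 0"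
      by (auto simp: f_def S0_def struct_const_def nf_eq split: if_splits)
  qed
  also have "\<dots> = sum h T"
  proof (rule sum.reindex_bij_witness[where
        i = "\<lambda>(r, m, j). (r, m, M - r + j, N - m - j)" and
        j = "\<lambda>(p, q, p', q'). (p, q, p' - (M - p))"])
    fix z assume "z \<in> S0"
    then obtain p q p' q' where z: "z = (p, q, p', q')" "p + q + p' + q' = ?D" "p \<le> M" "M \<le> p + p'"
      by (auto simp: S0_def)
    have e: "M - p + (p' - (M - p)) = p'" "N - q - (p' - (M - p)) = q'" using z by auto
    have c: "p' choose (M - p) = p' choose (p' - (M - p))"
      using z by (intro binomial_symmetric) auto
    have n: "nf q p' q' (M - p) N
        = (-1) ^ (p' - (M - p)) * int (p' choose (p' - (M - p))) * pochhammer (int q) (p' - (M - p))"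
      unfolding nf_eq c using z by auto
    have "(of_int (pochhammer (int q) i) :: complex) = pochhammer (of_nat q) i" for i
      by (simp flip: pochhammer_of_int)
    then show "h (case z of (p, q, p', q') \<Rightarrow> (p, q, p' - (M - p))) = f z"
      using z by (simp only: h_def f_def prod.case e if_True refl struct_const_def n
          of_int_mult of_int_power of_int_minus of_int_1 of_int_of_nat_eq)
  qed (auto simp: S0_def T_def)
  also have "\<dots> = (\<Sum>r\<le>M. \<Sum>m\<le>N. \<Sum>j\<le>N - m. h (r, m, j))"
    unfolding T_def by (simp add: sum.cartesian_product[symmetric] sum.Sigma case_prod_unfold)
  finally show ?thesis unfolding h_def by simp
qed

section \<open>Incomplete beta integrals as weights\<close>

definition beta_wt :: "nat \<Rightarrow> nat \<Rightarrow> real" where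
  "beta_wt p q = integral {1/2..1} (\<lambda>s. s ^ p * (1 - s) ^ q)"

lemma beta_wt_integrable: "(\<lambda>s::real. s ^ p * (1 - s) ^ q) integrable_on {a..b}"
  by (intro integrable_continuous_real continuous_intros)

lemma beta_wt_le_1: "beta_wt p q \<le> 1"
proof -
  have "beta_wt p q \<le> integral {1/2..1::real} (\<lambda>s. 1)"
    unfolding beta_wt_def
    by (intro integral_le beta_wt_integrable integrable_const_ivl) (auto intro!: mult_le_one power_le_one)
  then show ?thesis by simp
qed

lemma beta_wt_antimono:
  assumes "p \<le> p'" "q \<le> q'"
  shows "beta_wt p' q' \<le> beta_wt p q"
  unfolding beta_wt_def
  by (intro integral_le beta_wt_integrable) (use assms in \<open>auto intro!: mult_mono power_decreasing\<close>)

text \<open>On \<open>[1/2, 1]\<close> a factor \<open>s\<close> costs at most 2. For the integral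
  over \<open>[0, 1]\<close> the corresponding ratio would be unbounded in \<open>q\<close>.\<close>

lemma beta_wt_le_2: "beta_wt p q \<le> 2 ^ k * beta_wt (p + k) q"
proof -
  have "beta_wt p q \<le> integral {1/2..1} (\<lambda>s. 2 ^ k * (s ^ (p + k) * (1 - s) ^ q))"
    unfolding beta_wt_def
  proof (intro integral_le beta_wt_integrable integrable_on_mult_right)
    fix s :: real assume s: "s \<in> {1/2..1}"
    then have "1 \<le> (2 * s) ^ k" by (intro one_le_power) auto
    then have "s ^ p * (1 - s) ^ q * 1 \<le> s ^ p * (1 - s) ^ q * (2 * s) ^ k"
      using s by (intro mult_left_mono) auto
    then show "s ^ p * (1 - s) ^ q \<le> 2 ^ k * (s ^ (p + k) * (1 - s) ^ q)"
      by (simp add: power_add power_mult_distrib ac_simps)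
  qed
  then show ?thesis by (simp add: beta_wt_def)
qed

text \<open>On \<open>[1/2, 3/4]\<close> both \<open>s\<close> and \<open>1 - s\<close> are at least
  \<open>1/4\<close>, and the length of the interval supplies the extra factor. Through this bound
  the weights are at most geometric, so they can be traded for the growth condition of
  \<open>Aconv\<close>.\<close>

lemma beta_wt_lower: "(1/4) ^ (p + q + 1) \<le> beta_wt p q"
proof -
  have "(1/4) ^ (p + q + 1) = integral {1/2..3/4::real} (\<lambda>s. (1/4) ^ (p + q) :: real)" by simp
  also have "\<dots> \<le> integral {1/2..3/4} (\<lambda>s. s ^ p * (1 - s) ^ q)"
    unfolding power_add
    by (intro integral_le beta_wt_integrable integrable_const_ivl mult_mono power_mono) auto
  also have "\<dots> \<le> beta_wt p q"
    unfolding beta_wt_def by (intro integral_subset_le beta_wt_integrable) auto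
  finally show ?thesis .
qed

lemma beta_wt_pos: "0 < beta_wt p q"
  by (rule less_le_trans[OF _ beta_wt_lower]) simp

text \<open>Integration by parts; the boundary term at \<open>1/2\<close> has the favourable sign.\<close>
lemma beta_wt_step: "real (Suc p) * beta_wt p (Suc q) \<le> real (Suc q) * beta_wt (Suc p) q"
proof -
  define F where "F = (\<lambda>s::real. s ^ Suc p * (1 - s) ^ Suc q)"
  have "((\<lambda>s. real (Suc p) * (s ^ p * (1 - s) ^ Suc q) - real (Suc q) * (s ^ Suc p * (1 - s) ^ q))
      has_integral (F 1 - F (1/2))) {1/2..1}"
    unfolding F_def
    by (rule fundamental_theorem_of_calculus)
      (auto intro!: derivative_eq_intros simp flip: has_real_derivative_iff_has_vector_derivative
        simp: algebra_simps simp del: power_Suc)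
  moreover have "((\<lambda>s. real (Suc p) * (s ^ p * (1 - s) ^ Suc q) - real (Suc q) * (s ^ Suc p * (1 - s) ^ q))
      has_integral (real (Suc p) * beta_wt p (Suc q) - real (Suc q) * beta_wt (Suc p) q)) {1/2..1}"
    unfolding beta_wt_def
    by (intro has_integral_diff has_integral_mult_right integrable_integral beta_wt_integrable)
  ultimately have "real (Suc p) * beta_wt p (Suc q) - real (Suc q) * beta_wt (Suc p) q = F 1 - F (1/2)"
    by (rule has_integral_unique[rotated])
  also have "\<dots> \<le> 0" by (simp add: F_def)
  finally show ?thesis by simp
qed

text \<open>Iterating the integration by parts moves \<open>j\<close> units from the exponent of
  \<open>1-s\<close> to that of \<open>s\<close>. The factorials are arranged so as to absorb the
  binomial that arises when \<open>j\<close> letters \<open>a\<close> become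
  \<open>b\<close>.\<close>

lemma beta_wt_shift:
  "beta_wt p (q + j) / (fact p * fact (q + j)) \<le> beta_wt (p + j) q / (fact (p + j) * fact q)"
proof (induction j arbitrary: q)
  case (Suc j)
  have "beta_wt p (Suc q + j) / (fact p * fact (Suc q + j)) \<le> beta_wt (p + j) (Suc q) / (fact (p + j) * fact (Suc q))"
    by (rule Suc)
  also have "\<dots> = real (Suc (p + j)) * beta_wt (p + j) (Suc q) / (real (Suc (p + j)) * real (Suc q) * (fact (p + j) * fact q))"
    by (simp add: field_simps del: of_nat_Suc)
  also have "\<dots> \<le> real (Suc q) * beta_wt (Suc (p + j)) q / (real (Suc (p + j)) * real (Suc q) * (fact (p + j) * fact q))"
    by (intro divide_right_mono beta_wt_step) auto
  also have "\<dots> = beta_wt (p + Suc j) q / (fact (p + Suc j) * fact q)"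
    by (simp add: field_simps del: of_nat_Suc)
  finally show ?case by simp
qed simp

section \<open>The quotient as solution of a recursion\<close>

lemma jmult_split:
  assumes "\<forall>r<k. g r 0 = 0"
  shows "jmult g u (P + k) N = g k 0 * u P N + (\<Sum>r\<in>{k<..P + k}. g r 0 * u (P + k - r) N)
    + (\<Sum>r\<le>P + k. \<Sum>m\<in>{1..N}. \<Sum>j\<le>N - m. g r m * u (P + k - r + j) (N - m - j) *
        ((-1) ^ j * of_nat (P + k - r + j choose j) * pochhammer (of_nat m) j))"
proof -
  let ?M = "P + k"
  let ?h = "\<lambda>r m. \<Sum>j\<le>N - m. g r m * u (?M - r + j) (N - m - j) *
        ((-1) ^ j * of_nat (?M - r + j choose j) * pochhammer (of_nat m) j)"
  \<comment> \<open>With \<open>m = 0\<close> no \<open>b\<close> has to pass anything: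
    \<open>(0)_j\<close> vanishes for \<open>j > 0\<close>.\<close>
  have h0: "?h r 0 = g r 0 * u (?M - r) N" for r
  proof -
    have "?h r 0 = (\<Sum>j\<le>N. if j = 0 then g r 0 * u (?M - r) N else 0)"
      by (intro sum.cong) (auto simp: pochhammer_0_left)
    then show ?thesis by simp
  qed
  have s: "{..N} = insert 0 {1..N}" by auto
  have "jmult g u ?M N = (\<Sum>r\<le>?M. ?h r 0 + (\<Sum>m\<in>{1..N}. ?h r m))"
    unfolding jmult_expand s by (intro sum.cong refl) simp
  also have "\<dots> = (\<Sum>r\<le>?M. g r 0 * u (?M - r) N) + (\<Sum>r\<le>?M. \<Sum>m\<in>{1..N}. ?h r m)"
    unfolding h0 by (rule sum.distrib)
  also have "(\<Sum>r\<le>?M. g r 0 * u (?M - r) N) = (\<Sum>r\<in>insert k {k<..?M}. g r 0 * u (?M - r) N)"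
    by (rule sum.mono_neutral_right) (auto simp: assms)
  also have "\<dots> = g k 0 * u P N + (\<Sum>r\<in>{k<..?M}. g r 0 * u (?M - r) N)"
    by simp
  finally show ?thesis .
qed

text \<open>In the coefficient of \<open>a^(P+k) b^N\<close>, the unknown \<open>u P N\<close>
  occurs with the nonzero factor \<open>g k 0\<close>. All other unknowns have either a smaller
  power of \<open>b\<close>, or the same one and a smaller power of \<open>a\<close>.\<close>

lemma division_recursion:
  fixes g x :: jseries
  assumes g: "\<forall>r<k. g r 0 = 0" and gk: "g k 0 \<noteq> 0"
  obtains u :: jseries where "\<And>P N. jmult g u (P + k) N = x (P + k) N"
proof -
  \<comment> \<open>The pairs carry the power of \<open>b\<close> first: for \<open>m > 0\<close>
    the power of \<open>a\<close> may grow beyond \<open>P\<close>, so only this lexicographic order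
    decreases.\<close>
  define H where "H = (\<lambda>v. \<lambda>(N, P). (x (P + k) N - (\<Sum>r\<in>{k<..P + k}. g r 0 * v (N, P + k - r))
    - (\<Sum>r\<le>P + k. \<Sum>m\<in>{1..N}. \<Sum>j\<le>N - m. g r m * v (N - m - j, P + k - r + j) *
        ((-1) ^ j * of_nat (P + k - r + j choose j) * pochhammer (of_nat m) j))) / g k 0)"
  define R where "R = less_than <*lex*> less_than"
  have "wf R" by (auto simp: R_def)
  moreover have "adm_wf R H"
    unfolding adm_wf_def
  proof (intro allI impI)
    fix f h :: "nat \<times> nat \<Rightarrow> complex" and z
    assume e: "\<forall>w. (w, z) \<in> R \<longrightarrow> f w = h w"
    obtain N P where z: "z = (N, P)" by (cases z)
    have e1: "f (N, P') = h (N, P')" if "P' < P" for P' using e that by (simp add: z R_def)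
    have e2: "f (N', P') = h (N', P')" if "N' < N" for N' P' using e that by (simp add: z R_def)
    have "(\<Sum>r\<in>{k<..P + k}. g r 0 * f (N, P + k - r)) = (\<Sum>r\<in>{k<..P + k}. g r 0 * h (N, P + k - r))"
      by (intro sum.cong refl) (auto simp: e1)
    moreover have "(\<Sum>r\<le>P + k. \<Sum>m\<in>{1..N}. \<Sum>j\<le>N - m. g r m * f (N - m - j, P + k - r + j) *
        ((-1) ^ j * of_nat (P + k - r + j choose j) * pochhammer (of_nat m) j))
      = (\<Sum>r\<le>P + k. \<Sum>m\<in>{1..N}. \<Sum>j\<le>N - m. g r m * h (N - m - j, P + k - r + j) *
        ((-1) ^ j * of_nat (P + k - r + j choose j) * pochhammer (of_nat m) j))"
      by (intro sum.cong refl) (auto simp: e2)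
    ultimately show "H f z = H h z" by (simp only: H_def z prod.case)
  qed
  ultimately have fix_eq: "wfrec R H = H (wfrec R H)" by (rule wfrec_fixpoint)
  define u where "u = (\<lambda>P N. wfrec R H (N, P))"
  have div_cancel: "g k 0 * v = w" if "v = w / g k 0" for v w
    using that gk by simp
  have sub_cancel: "v + a + b = w" if "v = w - a - b" for v w a b :: complex
    using that by simp
  have "jmult g u (P + k) N = x (P + k) N" for P N
  proof -
    have "u P N = (x (P + k) N - (\<Sum>r\<in>{k<..P + k}. g r 0 * u (P + k - r) N)
    - (\<Sum>r\<le>P + k. \<Sum>m\<in>{1..N}. \<Sum>j\<le>N - m. g r m * u (P + k - r + j) (N - m - j) *
        ((-1) ^ j * of_nat (P + k - r + j choose j) * pochhammer (of_nat m) j))) / g k 0"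
      unfolding u_def by (subst fix_eq) (simp add: H_def)
    then have "g k 0 * u P N = x (P + k) N - (\<Sum>r\<in>{k<..P + k}. g r 0 * u (P + k - r) N)
    - (\<Sum>r\<le>P + k. \<Sum>m\<in>{1..N}. \<Sum>j\<le>N - m. g r m * u (P + k - r + j) (N - m - j) *
        ((-1) ^ j * of_nat (P + k - r + j choose j) * pochhammer (of_nat m) j))"
      by (rule div_cancel)
    then show ?thesis unfolding jmult_split[of k g, OF g] by (rule sub_cancel)
  qed
  then show ?thesis by (rule that)
qed

section \<open>Majorant estimates for products and quotients\<close>

lemma pochhammer_of_nat_nonneg: "0 \<le> pochhammer (real m) j"
  unfolding pochhammer_prod by (intro prod_nonneg) auto

lemma pochhammer_le: "pochhammer (real m) j \<le> 2 ^ (m + j) * fact j"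
proof -
  have "pochhammer (real m) j \<le> pochhammer (real m + 1) j"
    unfolding pochhammer_prod by (intro prod_mono) auto
  also have "\<dots> = fact (m + j) / fact m"
    using pochhammer_product'[of "1::real" m j] by (simp add: pochhammer_fact[symmetric] add.commute)
  also have "\<dots> = real (m + j choose m) * fact j"
    by (simp add: binomial_fact)
  also have "\<dots> \<le> real (2 ^ (m + j)) * fact j"
    by (intro mult_right_mono of_nat_mono binomial_le_pow2) auto
  finally show ?thesis by simp
qed

lemma fact_mult_le: "fact m * fact n \<le> (fact (m + n) :: real)"
proof -
  have "(fact m * fact n :: nat) \<le> fact (m + n)"
    by (intro dvd_imp_le fact_fact_dvd_fact) auto
  then have "real (fact m * fact n) \<le> real (fact (m + n))" by (rule of_nat_mono)
  then show ?thesis by simp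
qed

definition div_wt :: "real \<Rightarrow> real \<Rightarrow> nat \<Rightarrow> nat \<Rightarrow> real" where
  "div_wt \<rho> \<sigma> p q = fact q / (\<rho> ^ p * \<sigma> ^ q * beta_wt p q)"

lemma div_wt_pos: "0 < \<rho> \<Longrightarrow> 0 < \<sigma> \<Longrightarrow> 0 < div_wt \<rho> \<sigma> p q"
  by (simp add: div_wt_def beta_wt_pos)

text \<open>This estimates one term of \<open>jmult_expand\<close>. The beta weight absorbs the
  binomial, \<open>(m)_j\<close> costs \<open>2^(m+j) j!\<close>, and \<open>m! (q+j)!\<close> is at
  most \<open>(q+j+m)!\<close>. What remains is geometric in \<open>r\<close>, \<open>m\<close> and
  \<open>j\<close>, hence summable once \<open>\<rho>\<close>, \<open>\<sigma>\<close> and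
  \<open>\<sigma> / \<rho>\<close> are small.\<close>

lemma div_wt_product:
  assumes "0 < \<rho>" "0 < \<sigma>"
  shows "fact m * div_wt \<rho> \<sigma> (p + j) q * (real (p + j choose j) * pochhammer (real m) j)
    \<le> div_wt \<rho> \<sigma> (p + r) (q + j + m) * \<rho> ^ r * (2 * \<sigma>) ^ m * (2 * \<sigma> / \<rho>) ^ j"
proof -
  have [simp]: "beta_wt p q \<noteq> 0" for p q using beta_wt_pos[of p q] by simp
  have V: "fact (p + j) * fact q / (fact p * beta_wt (p + j) q) \<le> fact (q + j) / beta_wt p (q + j)"
    using beta_wt_shift[of p q j] beta_wt_pos[of p "q + j"] beta_wt_pos[of "p + j" q]
    by (simp add: field_simps)
  have b: "real (p + j choose j) = fact (p + j) / (fact j * fact p)"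
    by (simp add: binomial_fact)
  have "fact m * div_wt \<rho> \<sigma> (p + j) q * (real (p + j choose j) * pochhammer (real m) j)
     = fact m * (fact (p + j) * fact q / (fact p * beta_wt (p + j) q)) * (pochhammer (real m) j / fact j)
       / (\<rho> ^ (p + j) * \<sigma> ^ q)"
    unfolding div_wt_def b by (simp add: ac_simps)
  also have "\<dots> \<le> fact m * (fact (q + j) / beta_wt p (q + j)) * 2 ^ (m + j) / (\<rho> ^ (p + j) * \<sigma> ^ q)"
    using assms pochhammer_le[of m j] beta_wt_pos[of p "q + j"] beta_wt_pos[of "p + j" q]
    by (intro divide_right_mono mult_mono V) (auto simp: divide_simps pochhammer_of_nat_nonneg)
  also have "\<dots> = fact m * fact (q + j) / beta_wt p (q + j) * 2 ^ (m + j) / (\<rho> ^ (p + j) * \<sigma> ^ q)"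
    by simp
  also have "\<dots> \<le> fact (q + j + m) / beta_wt (p + r) (q + j + m) * 2 ^ (m + j) / (\<rho> ^ (p + j) * \<sigma> ^ q)"
    using assms fact_mult_le[of m "q + j"] beta_wt_pos[of "p + r" "q + j + m"]
    by (intro divide_right_mono mult_right_mono frac_le beta_wt_antimono) (auto simp: ac_simps)
  also have "\<dots> = div_wt \<rho> \<sigma> (p + r) (q + j + m) * \<rho> ^ r * (2 * \<sigma>) ^ m * (2 * \<sigma> / \<rho>) ^ j"
  proof -
    have "F / V * (A * B) / ((a * c) * d) = F / ((a * b) * (d * e * f) * V) * b * (A * f) * ((B * e) / c)"
      if "a \<noteq> 0" "b \<noteq> 0" "c \<noteq> 0" "d \<noteq> 0" "e \<noteq> 0" "f \<noteq> 0" "V \<noteq> 0" for F V A B a b c d e f :: real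
      using that by (simp add: divide_simps)
    from this[of "\<rho> ^ p" "\<rho> ^ r" "\<rho> ^ j" "\<sigma> ^ q" "\<sigma> ^ j" "\<sigma> ^ m"] show ?thesis
      using assms unfolding div_wt_def power_add power_mult_distrib power_divide by simp
  qed
  finally show ?thesis .
qed

text \<open>This is the price of dividing by \<open>a^k\<close>: a constant independent of
  \<open>p\<close> and \<open>q\<close>, thanks to the truncated integral.\<close>

lemma div_wt_lower_exponent:
  assumes "0 < \<rho>" "0 < \<sigma>"
  shows "div_wt \<rho> \<sigma> (p + k) q \<le> (2 / \<rho>) ^ k * div_wt \<rho> \<sigma> p q"
proof -
  have "1 / beta_wt (p + k) q \<le> 2 ^ k / beta_wt p q"
    using beta_wt_le_2[of p q k] beta_wt_pos[of p q] beta_wt_pos[of "p + k" q] by (simp add: field_simps)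
  then have "fact q / (\<rho> ^ (p + k) * \<sigma> ^ q) * (1 / beta_wt (p + k) q)
      \<le> fact q / (\<rho> ^ (p + k) * \<sigma> ^ q) * (2 ^ k / beta_wt p q)"
    using assms by (intro mult_left_mono) auto
  then show ?thesis by (simp add: div_wt_def power_add power_divide ac_simps)
qed

lemma geometric_sum_le_2:
  fixes y :: real assumes "0 \<le> y" "y \<le> 1 / 2"
  shows "(\<Sum>i<n. y ^ i) \<le> 2"
proof -
  have "(\<Sum>i<n. y ^ i) = (1 - y ^ n) / (1 - y)" using assms by (subst sum_gp_strict) auto
  also have "\<dots> \<le> 1 / (1 / 2)" using assms by (intro frac_le) auto
  finally show ?thesis by simp
qed

lemma geometric_sum_le:
  fixes y :: real assumes "0 \<le> y" "y \<le> 1 / 2"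
  shows "(\<Sum>i\<in>{k<..n}. y ^ i) \<le> 2 * y ^ Suc k" "(\<Sum>i\<le>n. y ^ i) \<le> 2"
proof -
  have "(\<Sum>i\<in>{k<..n}. y ^ i) = (\<Sum>i<n - k. y ^ Suc k * y ^ i)"
    by (rule sum.reindex_bij_witness[where i = "\<lambda>i. i + Suc k" and j = "\<lambda>i. i - Suc k"])
      (auto simp add: power_add[symmetric] simp del: power_Suc)
  also have "\<dots> = y ^ Suc k * (\<Sum>i<n - k. y ^ i)" by (rule sum_distrib_left[symmetric])
  also have "\<dots> \<le> y ^ Suc k * 2" using assms by (intro mult_left_mono geometric_sum_le_2) auto
  finally show "(\<Sum>i\<in>{k<..n}. y ^ i) \<le> 2 * y ^ Suc k" by simp
  show "(\<Sum>i\<le>n. y ^ i) \<le> 2"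
    using geometric_sum_le_2[OF assms, of "Suc n"] by (simp add: lessThan_Suc_atMost)
qed

lemma AconvI:
  assumes "1 < R" "0 \<le> C" "\<And>p q. norm (x p q) \<le> C * R ^ (p + q) * fact q"
  shows "x \<in> Aconv"
proof -
  have "norm (x p q) \<le> (C + 1) * R ^ (p + q) * fact q" for p q
  proof -
    have "C * (R ^ (p + q) * fact q) \<le> (C + 1) * (R ^ (p + q) * fact q)"
      using assms by (intro mult_right_mono) auto
    then show ?thesis using assms(3)[of p q] by (simp only: mult.assoc)
  qed
  moreover have "0 < C + 1" using assms by simp
  ultimately show ?thesis unfolding Aconv_def using assms(1) by blast
qed

text \<open>The first sum starts at \<open>r = k+1\<close> and gains \<open>\<rho>^(k+1)\<close>,
  one power more than the \<open>\<rho>^k\<close> lost in dividing by \<open>a^k\<close>. The second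
  starts at \<open>m = 1\<close> and gains a factor \<open>\<sigma>\<close>, which can be chosen
  after \<open>\<rho>\<close>.\<close>

lemma division_step_bound:
  fixes g u :: jseries
  assumes pos: "0 < \<rho>" "0 < \<sigma>" "0 \<le> B" "0 < S" "0 \<le> K"
    and g: "\<And>r m. norm (g r m) \<le> K * S ^ (r + m) * fact m"
    and u: "\<And>p' q'. q' < N \<or> q' = N \<and> p' < P \<Longrightarrow> norm (u p' q') \<le> B * div_wt \<rho> \<sigma> p' q'"
    and small: "S * \<rho> \<le> 1 / 2" "2 * S * \<sigma> \<le> 1 / 2" "2 * \<sigma> / \<rho> \<le> 1 / 2"
  shows "norm (\<Sum>r\<in>{k<..P + k}. g r 0 * u (P + k - r) N)
      \<le> K * B * div_wt \<rho> \<sigma> (P + k) N * (2 * (S * \<rho>) ^ Suc k)" (is ?A)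
    and "norm (\<Sum>r\<le>P + k. \<Sum>m\<in>{1..N}. \<Sum>j\<le>N - m. g r m * u (P + k - r + j) (N - m - j) *
        ((-1) ^ j * of_nat (P + k - r + j choose j) * pochhammer (of_nat m) j))
      \<le> K * B * div_wt \<rho> \<sigma> (P + k) N * (16 * S * \<sigma>)" (is ?B)
proof -
  define W where "W = K * B * div_wt \<rho> \<sigma> (P + k) N"
  have W: "0 \<le> W" using pos div_wt_pos[of \<rho> \<sigma> "P + k" N] by (simp add: W_def)
  \<comment> \<open>One estimate serves both sums: the first one is the case
    \<open>m = j = 0\<close>, \<open>r > k\<close>.\<close>
  have term_le: "norm (g r m * u (P + k - r + j) (N - m - j) *
        ((-1) ^ j * of_nat (P + k - r + j choose j) * pochhammer (of_nat m) j))
      \<le> W * (S * \<rho>) ^ r * (2 * S * \<sigma>) ^ m * (2 * \<sigma> / \<rho>) ^ j"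
    if h: "r \<le> P + k" "m \<le> N" "j \<le> N - m" "m \<ge> 1 \<or> j = 0 \<and> r > k" for r m j
  proof -
    have u': "norm (u (P + k - r + j) (N - m - j)) \<le> B * div_wt \<rho> \<sigma> (P + k - r + j) (N - m - j)"
      by (rule u) (use h in auto)
    have ph: "norm (pochhammer (of_nat m) j :: complex) = pochhammer (real m) j"
      by (simp add: pochhammer_of_nat)
    have "norm (g r m * u (P + k - r + j) (N - m - j) *
        ((-1) ^ j * of_nat (P + k - r + j choose j) * pochhammer (of_nat m) j))
      = norm (g r m) * norm (u (P + k - r + j) (N - m - j)) *
        (real (P + k - r + j choose j) * pochhammer (real m) j)"
      by (simp add: norm_mult norm_power ph)
    also have "\<dots> \<le> (K * S ^ (r + m) * fact m) * (B * div_wt \<rho> \<sigma> (P + k - r + j) (N - m - j)) *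
        (real (P + k - r + j choose j) * pochhammer (real m) j)"
      using pos by (intro mult_mono g u') (auto intro!: mult_nonneg_nonneg pochhammer_of_nat_nonneg less_imp_le[OF div_wt_pos])
    also have "\<dots> = K * B * S ^ (r + m) * (fact m * div_wt \<rho> \<sigma> (P + k - r + j) (N - m - j) *
        (real (P + k - r + j choose j) * pochhammer (real m) j))"
      by (simp add: ac_simps)
    also have "\<dots> \<le> K * B * S ^ (r + m) * (div_wt \<rho> \<sigma> (P + k - r + r) (N - m - j + j + m) *
        \<rho> ^ r * (2 * \<sigma>) ^ m * (2 * \<sigma> / \<rho>) ^ j)"
      using pos by (intro mult_left_mono div_wt_product) auto
    also have "\<dots> = W * (S * \<rho>) ^ r * (2 * S * \<sigma>) ^ m * (2 * \<sigma> / \<rho>) ^ j"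
      using h by (simp add: W_def power_add power_mult_distrib)
    finally show ?thesis .
  qed
  have "norm (\<Sum>r\<in>{k<..P + k}. g r 0 * u (P + k - r) N) \<le> (\<Sum>r\<in>{k<..P + k}. W * (S * \<rho>) ^ r)"
    by (rule sum_norm_le) (use term_le[of _ 0 0] in auto)
  also have "\<dots> = W * (\<Sum>r\<in>{k<..P + k}. (S * \<rho>) ^ r)" by (rule sum_distrib_left[symmetric])
  also have "\<dots> \<le> W * (2 * (S * \<rho>) ^ Suc k)"
    using pos small W by (intro mult_left_mono geometric_sum_le) auto
  finally show ?A by (simp add: W_def)
  have "norm (\<Sum>r\<le>P + k. \<Sum>m\<in>{1..N}. \<Sum>j\<le>N - m. g r m * u (P + k - r + j) (N - m - j) *
        ((-1) ^ j * of_nat (P + k - r + j choose j) * pochhammer (of_nat m) j))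
      \<le> (\<Sum>r\<le>P + k. \<Sum>m\<in>{1..N}. \<Sum>j\<le>N - m. W * (S * \<rho>) ^ r * (2 * S * \<sigma>) ^ m * (2 * \<sigma> / \<rho>) ^ j)"
    by (intro sum_norm_le term_le) auto
  also have "\<dots> = W * (\<Sum>r\<le>P + k. (S * \<rho>) ^ r *
      (\<Sum>m\<in>{1..N}. (2 * S * \<sigma>) ^ m * (\<Sum>j\<le>N - m. (2 * \<sigma> / \<rho>) ^ j)))"
    by (simp add: sum_distrib_left mult.assoc)
  also have "\<dots> \<le> W * (\<Sum>r\<le>P + k. (S * \<rho>) ^ r * (\<Sum>m\<in>{0<..N}. (2 * S * \<sigma>) ^ m * 2))"
  proof -
    have "{1..N} = {0<..N}" by auto
    moreover have "(2 * S * \<sigma>) ^ m * (\<Sum>j\<le>N - m. (2 * \<sigma> / \<rho>) ^ j) \<le> (2 * S * \<sigma>) ^ m * 2" for m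
      using pos small by (intro mult_left_mono geometric_sum_le) auto
    then have "(\<Sum>m\<in>{0<..N}. (2 * S * \<sigma>) ^ m * (\<Sum>j\<le>N - m. (2 * \<sigma> / \<rho>) ^ j))
        \<le> (\<Sum>m\<in>{0<..N}. (2 * S * \<sigma>) ^ m * 2)" by (rule sum_mono)
    then have "(S * \<rho>) ^ r * (\<Sum>m\<in>{0<..N}. (2 * S * \<sigma>) ^ m * (\<Sum>j\<le>N - m. (2 * \<sigma> / \<rho>) ^ j))
        \<le> (S * \<rho>) ^ r * (\<Sum>m\<in>{0<..N}. (2 * S * \<sigma>) ^ m * 2)" for r
      by (rule mult_left_mono) (use pos in auto)
    ultimately show ?thesis
      by (simp only:) (rule mult_left_mono[OF sum_mono W])
  qed
  also have "\<dots> = W * ((\<Sum>r\<le>P + k. (S * \<rho>) ^ r) * ((\<Sum>m\<in>{0<..N}. (2 * S * \<sigma>) ^ m) * 2))"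
    by (simp add: sum_distrib_right)
  also have "\<dots> \<le> W * (2 * (2 * (2 * S * \<sigma>) ^ Suc 0 * 2))"
    using pos small W
    by (intro mult_left_mono mult_mono geometric_sum_le mult_right_mono) (auto intro!: sum_nonneg)
  also have "\<dots> = W * (16 * S * \<sigma>)" by simp
  finally show ?B by (simp add: W_def)
qed

text \<open>The formal quotient is bounded by \<open>B\<close> times the weight, by induction along
  the recursion. At each coefficient the dividend uses half of the admissible bound and the two sums
  of known terms a quarter each.\<close>

theorem weierstrass_division:
  assumes "g \<in> Aconv" "x \<in> Aconv"
    and g0: "\<forall>r<k. g r 0 = 0" and gk: "g k 0 \<noteq> 0"
  obtains u where "u \<in> Aconv" "\<And>p q. jmult g u (p + k) q = x (p + k) q"
proof -
  obtain u where u: "\<And>P N. jmult g u (P + k) N = x (P + k) N"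
    using division_recursion[of k g x, OF g0 gk] by blast
  obtain S C where S: "S > 1" "C > 0" and gb: "\<And>r m. norm (g r m) \<le> C * S ^ (r + m) * fact m"
    using assms(1) unfolding Aconv_def by blast
  obtain R D where R: "R > 1" "D > 0" and xb: "\<And>r m. norm (x r m) \<le> D * R ^ (r + m) * fact m"
    using assms(2) unfolding Aconv_def by blast
  define c where "c = norm (g k 0)"
  define K where "K = C / c"
  define X where "X = D / c"
  have c: "c > 0" using gk by (simp add: c_def)
  have K: "K > 0" "C = c * K" and X: "X > 0" "D = c * X" using c S R by (auto simp: K_def X_def)
  \<comment> \<open>The three entries give \<open>S \<rho> \<le> 1/2\<close>, compare the growth of
    \<open>x\<close> with the weight, and make the first sum small even after division by
    \<open>a^k\<close>.\<close>
  define \<rho> where "\<rho> = min (1 / (2 * S)) (min (1 / R) (1 / (8 * K * S ^ Suc k * 2 ^ k)))"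
  \<comment> \<open>Chosen after \<open>\<rho>\<close>, so that the loss
    \<open>(2 / \<rho>)^k\<close> in the second sum is already a fixed constant.\<close>
  define \<sigma> where "\<sigma> = min (\<rho> / 4) (min (1 / (4 * S)) (1 / (64 * K * S * (2 / \<rho>) ^ k)))"
  have \<rho>: "\<rho> > 0" using S R K by (auto simp: \<rho>_def)
  then have \<sigma>: "\<sigma> > 0" using S K by (auto simp: \<sigma>_def)
  have clear_denom: "t * s \<le> 1" if "s \<le> 1 / t" "0 < t" for s t :: real
    using that by (simp add: pos_le_divide_eq mult.commute)
  have "2 * S * \<rho> \<le> 1" "R * \<rho> \<le> 1" "8 * K * S ^ Suc k * 2 ^ k * \<rho> \<le> 1"
    using S R K by (auto intro!: clear_denom mult_pos_pos simp: \<rho>_def simp del: power_Suc)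
  then have \<rho>b: "S * \<rho> \<le> 1 / 2" "R * \<rho> \<le> 1" "2 * K * S ^ Suc k * 2 ^ k * \<rho> \<le> 1 / 4"
    by (auto simp del: power_Suc)
  have "4 * S * \<sigma> \<le> 1" "64 * K * S * (2 / \<rho>) ^ k * \<sigma> \<le> 1"
    using S K \<rho> by (auto intro!: clear_denom mult_pos_pos simp: \<sigma>_def)
  then have \<sigma>b1: "2 * S * \<sigma> \<le> 1 / 2" "16 * K * S * (2 / \<rho>) ^ k * \<sigma> \<le> 1 / 4"
    by auto
  have "\<sigma> \<le> \<rho> / 4" by (simp add: \<sigma>_def)
  then have \<sigma>b2: "2 * \<sigma> / \<rho> \<le> 1 / 2" "\<sigma> \<le> \<rho>"
    using \<rho> by (auto simp: pos_divide_le_eq)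
  note \<sigma>b = \<sigma>b2(1) \<sigma>b1 \<sigma>b2(2)
  \<comment> \<open>The factor 2 makes the contribution of \<open>x\<close> exactly half of the
    target bound.\<close>
  define B where "B = 2 * X * (2 / \<rho>) ^ k"
  have B: "B > 0" using X \<rho> by (simp add: B_def)
  have sub_cancel: "v = w - a - b" if "v + a + b = w" for v w a b :: complex
    unfolding that[symmetric] by simp
  have ub_pair: "norm (u (snd z) (fst z)) \<le> B * div_wt \<rho> \<sigma> (snd z) (fst z)" for z
  proof (induction z rule: wf_induct_rule[OF wf_lex_prod[OF wf_less_than wf_less_than]])
    case (1 z)
    obtain N P where z: "z = (N, P)" by (cases z)
    let ?w = "div_wt \<rho> \<sigma> P N" and ?w' = "div_wt \<rho> \<sigma> (P + k) N"
    have w: "0 < ?w" "0 < ?w'" "?w' \<le> (2 / \<rho>) ^ k * ?w"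
      using \<rho> \<sigma> by (auto intro: div_wt_pos div_wt_lower_exponent)
    have IH: "norm (u p' q') \<le> B * div_wt \<rho> \<sigma> p' q'" if "q' < N \<or> q' = N \<and> p' < P" for p' q'
      using 1[of "(q', p')"] that by (auto simp: z)
    note bounds = division_step_bound[OF \<rho> \<sigma> _ _ _ gb IH \<rho>b(1) \<sigma>b(2,1), where k = k]
    let ?s0 = "\<Sum>r\<in>{k<..P + k}. g r 0 * u (P + k - r) N"
    let ?s1 = "\<Sum>r\<le>P + k. \<Sum>m\<in>{1..N}. \<Sum>j\<le>N - m. g r m * u (P + k - r + j) (N - m - j) *
        ((-1) ^ j * of_nat (P + k - r + j choose j) * pochhammer (of_nat m) j)"
    have "norm ?s0 \<le> C * B * ?w' * (2 * (S * \<rho>) ^ Suc k)"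
      by (rule bounds(1)) (use B S in auto)
    also have "\<dots> \<le> C * B * ((2 / \<rho>) ^ k * ?w) * (2 * (S * \<rho>) ^ Suc k)"
      using B S \<rho> w by (intro mult_right_mono mult_left_mono) auto
    also have "\<dots> = c * B * ?w * (2 * K * S ^ Suc k * 2 ^ k * \<rho>)"
      using \<rho> by (simp add: K power_divide power_mult_distrib)
    also have "\<dots> \<le> c * B * ?w * (1 / 4)"
      using c B w \<rho>b(3) by (intro mult_left_mono) auto
    finally have s0: "norm ?s0 \<le> c * B * ?w * (1 / 4)" .
    have "norm ?s1 \<le> C * B * ?w' * (16 * S * \<sigma>)"
      by (rule bounds(2)) (use B S in auto)
    also have "\<dots> \<le> C * B * ((2 / \<rho>) ^ k * ?w) * (16 * S * \<sigma>)"
      using B S \<sigma> w by (intro mult_right_mono mult_left_mono) auto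
    also have "\<dots> = c * B * ?w * (16 * K * S * (2 / \<rho>) ^ k * \<sigma>)"
      by (simp add: K)
    also have "\<dots> \<le> c * B * ?w * (1 / 4)"
      using c B w \<sigma>b(3) by (intro mult_left_mono) auto
    finally have s1: "norm ?s1 \<le> c * B * ?w * (1 / 4)" .
    \<comment> \<open>The growth of \<open>x\<close> lies below the weight, because
      \<open>R \<rho>\<close>, \<open>R \<sigma>\<close> and the beta weight are all at most
      1.\<close>
    have "R ^ (P + k + N) * (\<rho> ^ (P + k) * \<sigma> ^ N * beta_wt (P + k) N)
        = (R * \<rho>) ^ (P + k) * (R * \<sigma>) ^ N * beta_wt (P + k) N"
      by (simp add: power_add power_mult_distrib)
    also have "\<dots> \<le> 1 * 1 * 1"
    proof -
      have "R * \<sigma> \<le> R * \<rho>" using R \<sigma>b(4) by (intro mult_left_mono) auto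
      then have "R * \<sigma> \<le> 1" using \<rho>b(2) by linarith
      then have "(R * \<rho>) ^ (P + k) \<le> 1" "(R * \<sigma>) ^ N \<le> 1"
        using R \<rho> \<sigma> \<rho>b(2) by (intro power_le_one; simp)+
      then show ?thesis
        using R \<rho> \<sigma> beta_wt_pos[of "P + k" N]
        by (intro mult_mono beta_wt_le_1) (auto intro: less_imp_le)
    qed
    finally have "R ^ (P + k + N) \<le> 1 / (\<rho> ^ (P + k) * \<sigma> ^ N * beta_wt (P + k) N)"
      using \<rho> \<sigma> beta_wt_pos[of "P + k" N] by (simp add: field_simps)
    then have "D * fact N * R ^ (P + k + N) \<le> D * fact N * (1 / (\<rho> ^ (P + k) * \<sigma> ^ N * beta_wt (P + k) N))"
      using R by (intro mult_left_mono) auto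
    then have "norm (x (P + k) N) \<le> D * ?w'"
      using xb[of "P + k" N] by (simp add: div_wt_def ac_simps)
    also have "\<dots> \<le> D * ((2 / \<rho>) ^ k * ?w)" using R w by (intro mult_left_mono) auto
    also have "\<dots> = c * B * ?w * (1 / 2)" by (simp add: B_def X)
    finally have s2: "norm (x (P + k) N) \<le> c * B * ?w * (1 / 2)" .
    have "g k 0 * u P N = x (P + k) N - ?s0 - ?s1"
      by (rule sub_cancel) (rule u[of P N, unfolded jmult_split[of k g, OF g0]])
    then have "c * norm (u P N) = norm (x (P + k) N - ?s0 - ?s1)"
      unfolding c_def norm_mult[symmetric] by (rule arg_cong)
    also have "\<dots> \<le> norm (x (P + k) N) + norm ?s0 + norm ?s1"
      by (rule order_trans[OF norm_triangle_ineq4 add_right_mono[OF norm_triangle_ineq4]])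
    also have "\<dots> \<le> c * (B * ?w)" using s0 s1 s2 by simp
    finally show ?case using c by (simp add: z)
  qed
  have ub: "norm (u P N) \<le> B * div_wt \<rho> \<sigma> P N" for P N
    using ub_pair[of "(N, P)"] by simp
  have "u \<in> Aconv"
  proof (rule AconvI)
    have "2 * \<sigma> \<le> 2 * S * \<sigma>" using S \<sigma> by simp
    then have "\<sigma> < 4" using \<sigma>b(2) by linarith
    then show "1 < 4 / \<sigma>" using \<sigma> by simp
    show "0 \<le> 4 * B" using B by simp
    fix p q
    \<comment> \<open>Replacing \<open>\<rho>\<close> by the smaller \<open>\<sigma>\<close> and the
      beta weight by its geometric lower bound leaves a single ratio
      \<open>4 / \<sigma>\<close>.\<close>
    have "1 / (\<rho> ^ p * \<sigma> ^ q * beta_wt p q) \<le> 1 / (\<sigma> ^ p * \<sigma> ^ q * (1 / 4) ^ (p + q + 1))"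
      using \<rho> \<sigma> \<sigma>b(4) beta_wt_lower[of p q] beta_wt_pos[of p q]
      by (intro frac_le mult_mono power_mono) (auto intro!: mult_pos_pos)
    also have "\<dots> = 4 * (4 / \<sigma>) ^ (p + q)"
      by (simp add: power_add power_divide)
    finally have "B * fact q * (1 / (\<rho> ^ p * \<sigma> ^ q * beta_wt p q)) \<le> B * fact q * (4 * (4 / \<sigma>) ^ (p + q))"
      using B by (intro mult_left_mono) auto
    then show "norm (u p q) \<le> 4 * B * (4 / \<sigma>) ^ (p + q) * fact q"
      using ub[of p q] by (simp add: div_wt_def ac_simps)
  qed
  with u show ?thesis by (intro that)
qed

section \<open>Operations preserving the growth condition\<close>

lemma fact_add_le: "fact (m + n) \<le> (2 ^ (m + n) * fact m * fact n :: real)"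
proof -
  have "fact (m + n) = real (m + n choose m) * fact m * fact n" by (simp add: binomial_fact)
  also have "\<dots> \<le> real (2 ^ (m + n)) * fact m * fact n"
    by (intro mult_right_mono of_nat_mono binomial_le_pow2) auto
  finally show ?thesis by simp
qed

lemma junshift_Aconv:
  assumes "x \<in> Aconv"
  shows "junshift j x \<in> Aconv"
proof -
  obtain R C where R: "1 < R" "0 < C" and x: "\<And>p q. norm (x p q) \<le> C * R ^ (p + q) * fact q"
    using assms unfolding Aconv_def by blast
  show ?thesis
  proof (rule AconvI)
    fix p q
    have "norm (junshift j x p q) \<le> C * R ^ (p + (q + j)) * fact (q + j)"
      unfolding junshift_def by (rule x)
    also have "\<dots> \<le> C * R ^ (p + (q + j)) * (2 ^ (q + j) * fact q * fact j)"
      using R by (intro mult_left_mono fact_add_le) auto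
    also have "\<dots> = (C * R ^ j * 2 ^ j * fact j) * (R ^ p * 1 * (2 * R) ^ q) * fact q"
      by (simp add: power_add power_mult_distrib)
    also have "\<dots> \<le> (C * R ^ j * 2 ^ j * fact j) * (R ^ p * 2 ^ p * (2 * R) ^ q) * fact q"
      using R by (intro mult_right_mono mult_left_mono) auto
    finally show "norm (junshift j x p q) \<le> (C * R ^ j * 2 ^ j * fact j) * (2 * R) ^ (p + q) * fact q"
      by (simp add: power_add power_mult_distrib ac_simps)
  qed (use R in auto)
qed

lemma Suc_le_power_2: "real (Suc n) \<le> 2 ^ n"
proof -
  have "Suc n \<le> 2 ^ n" by (simp add: Suc_leI)
  then have "real (Suc n) \<le> real (2 ^ n)" by (rule of_nat_mono)
  then show ?thesis by simp
qed

lemma jtwist_Aconv: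
  assumes "x \<in> Aconv"
  shows "jtwist x \<in> Aconv"
proof -
  obtain R C where R: "1 < R" "0 < C" and x: "\<And>p q. norm (x p q) \<le> C * R ^ (p + q) * fact q"
    using assms unfolding Aconv_def by blast
  show ?thesis
  proof (rule AconvI)
    fix p q
    let ?b = "C * R ^ (p + q) * fact q"
    have b: "0 \<le> ?b" using R by simp
    have 1: "1 \<le> (2 :: real) ^ (p + q)" by simp
    have "norm (if q = 0 then 0 else of_nat (Suc p) * x (Suc p) (q - 1)) \<le> 2 ^ (p + q) * ?b"
    proof (cases q)
      case 0
      then show ?thesis using R by simp
    next
      case (Suc q')
      have "norm (of_nat (Suc p) * x (Suc p) q') = real (Suc p) * norm (x (Suc p) q')"
        by (simp only: norm_mult norm_of_nat)
      also have "\<dots> \<le> 2 ^ (p + q) * (C * R ^ (p + q) * fact q)"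
      proof (intro mult_mono)
        have "(2::real) ^ p \<le> 2 ^ (p + q)" by (intro power_increasing) auto
        then show "real (Suc p) \<le> 2 ^ (p + q)" using Suc_le_power_2[of p] by linarith
        have "C * R ^ (p + q) * fact q' \<le> C * R ^ (p + q) * fact q"
          using R Suc by (intro mult_left_mono fact_mono) auto
        then show "norm (x (Suc p) q') \<le> C * R ^ (p + q) * fact q"
          using x[of "Suc p" q'] Suc by simp
      qed auto
      finally show ?thesis using Suc by simp
    qed
    moreover have "norm (x p q) \<le> 2 ^ (p + q) * ?b"
      using x[of p q] mult_right_mono[OF 1 b] by linarith
    ultimately have "norm (jtwist x p q) \<le> 2 ^ (p + q) * ?b + 2 ^ (p + q) * ?b"
      unfolding jtwist_def by (intro norm_triangle_le add_mono)
    then show "norm (jtwist x p q) \<le> (2 * C) * (2 * R) ^ (p + q) * fact q"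
      by (simp add: power_mult_distrib ac_simps)
  qed (use R in auto)
qed

lemma jtwist_funpow_Aconv: "x \<in> Aconv \<Longrightarrow> (jtwist ^^ j) x \<in> Aconv"
  by (induction j) (auto simp: jtwist_Aconv)

text \<open>Reordering creates the factor \<open>(q)_(n-q)\<close>, and
  \<open>q! (q)_(n-q) \<le> n!\<close> keeps the factorial growth. The binomial and the number of
  terms are each at most \<open>2^(m+n)\<close>.\<close>

lemma jrev_Aconv:
  assumes "x \<in> Aconv"
  shows "jrev x \<in> Aconv"
proof -
  obtain R C where R: "1 < R" "0 < C" and x: "\<And>p q. norm (x p q) \<le> C * R ^ (p + q) * fact q"
    using assms unfolding Aconv_def by blast
  show ?thesis
  proof (rule AconvI)
    fix m n
    let ?b = "C * (2 * R) ^ (m + n) * fact n"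
    have b: "0 \<le> ?b" using R by simp
    have "norm ((-1) ^ q * x (m + n - q) q * of_int (nf q (m + n - q) 0 m n)) \<le> ?b" if q: "q \<le> m + n" for q
    proof (cases "q \<le> n")
      case False
      then have "nf q (m + n - q) 0 m n = 0" by (auto simp: nf_eq)
      then show ?thesis using b by simp
    next
      case True
      have "pochhammer (real q) (n - q) * fact q \<le> pochhammer (real q + 1) (n - q) * fact q"
        unfolding pochhammer_prod by (intro mult_right_mono prod_mono) auto
      also have "\<dots> = fact n"
        using pochhammer_product'[of "1::real" q "n - q"] True by (simp add: pochhammer_fact[symmetric] add.commute)
      finally have ph: "pochhammer (real q) (n - q) * fact q \<le> fact n" .
      have "real (m + n - q choose m) \<le> real (2 ^ (m + n - q))"
        by (intro of_nat_mono binomial_le_pow2)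
      also have "\<dots> \<le> 2 ^ (m + n)" by (simp add: power_increasing)
      finally have bin: "real (m + n - q choose m) \<le> 2 ^ (m + n)" .
      have "norm (of_int (nf q (m + n - q) 0 m n) :: complex)
          = real (m + n - q choose m) * pochhammer (real q) (n - q)"
      proof -
        have "\<bar>pochhammer (int q) (n - q)\<bar> = pochhammer (int q) (n - q)"
          unfolding pochhammer_prod by (intro abs_of_nonneg prod_nonneg) auto
        moreover have "m + n - q - m = n - q" by simp
        ultimately have "\<bar>nf q (m + n - q) 0 m n\<bar> = int (m + n - q choose m) * pochhammer (int q) (n - q)"
          using True by (simp add: nf_eq abs_mult power_abs)
        then have "real_of_int \<bar>nf q (m + n - q) 0 m n\<bar>
            = real (m + n - q choose m) * pochhammer (real q) (n - q)"
          by (simp add: pochhammer_of_int[symmetric])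
        then show ?thesis by (simp add: norm_of_int)
      qed
      then have "norm ((-1) ^ q * x (m + n - q) q * of_int (nf q (m + n - q) 0 m n))
        = norm (x (m + n - q) q) * (real (m + n - q choose m) * pochhammer (real q) (n - q))"
        by (simp add: norm_mult norm_power)
      also have "\<dots> \<le> (C * R ^ (m + n) * fact q) * (2 ^ (m + n) * pochhammer (real q) (n - q))"
        using x[of "m + n - q" q] q R bin
        by (intro mult_mono mult_right_mono) (auto simp: pochhammer_of_nat_nonneg)
      also have "\<dots> = C * R ^ (m + n) * 2 ^ (m + n) * (pochhammer (real q) (n - q) * fact q)"
        by (simp add: ac_simps)
      also have "\<dots> \<le> C * R ^ (m + n) * 2 ^ (m + n) * fact n"
        using R ph by (intro mult_left_mono) auto
      finally show ?thesis by (simp add: power_mult_distrib ac_simps)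
    qed
    then have "norm (jrev x m n) \<le> (\<Sum>q\<le>m + n. ?b)"
      unfolding jrev_def by (intro sum_norm_le) auto
    also have "\<dots> = real (Suc (m + n)) * ?b" by simp
    also have "\<dots> \<le> 2 ^ (m + n) * ?b" using b by (intro mult_right_mono Suc_le_power_2)
    also have "\<dots> = C * (4 * R) ^ (m + n) * fact n"
    proof -
      have "(4 * R) ^ (m + n) = 2 ^ (m + n) * (2 * R) ^ (m + n)"
        unfolding power_mult_distrib[symmetric] by simp
      then show ?thesis by (simp only: mult_ac)
    qed
    finally show "norm (jrev x m n) \<le> C * (4 * R) ^ (m + n) * fact n" .
  qed (use R in auto)
qed

subsection \<open>Leading exponents and ideals\<close>

definition lead_exp :: "jseries set \<Rightarrow> nat \<Rightarrow> nat \<Rightarrow> bool" where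
  "lead_exp I k j \<longleftrightarrow> (\<exists>x\<in>I. (\<forall>p q. q < j \<longrightarrow> x p q = 0) \<and> (\<forall>p<k. x p j = 0) \<and> x k j \<noteq> 0)"

definition min_lead :: "jseries set \<Rightarrow> nat \<Rightarrow> enat" where
  "min_lead I j = (if \<exists>k. lead_exp I k j then enat (LEAST k. lead_exp I k j) else \<infinity>)"

lemma min_lead_le: "lead_exp I k j \<Longrightarrow> min_lead I j \<le> enat k"
  by (auto simp: min_lead_def intro: Least_le)

lemma min_lead_attained: "min_lead I j = enat k \<Longrightarrow> lead_exp I k j"
  by (auto simp: min_lead_def intro: LeastI split: if_splits)

lemma min_lead_mono:
  assumes "\<And>k. lead_exp I k j \<Longrightarrow> lead_exp I' k j'"
  shows "min_lead I' j' \<le> min_lead I j"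
proof (cases "min_lead I j")
  case (enat k)
  then show ?thesis using assms min_lead_attained min_lead_le by metis
qed simp

lemma lead_exp_subset: "I \<subseteq> I' \<Longrightarrow> lead_exp I k j \<Longrightarrow> lead_exp I' k j"
  unfolding lead_exp_def by blast

lemma jb_Aconv: "jb \<in> Aconv"
  by (rule AconvI[of 2 1]) (auto simp: jb_def)

lemma lead_exp_Suc:
  assumes "right_ideal I" "lead_exp I k j"
  shows "lead_exp I k (Suc j)"
proof -
  obtain x where x: "x \<in> I" "\<forall>p q. q < j \<longrightarrow> x p q = 0" "\<forall>p<k. x p j = 0" "x k j \<noteq> 0"
    using assms(2) unfolding lead_exp_def by blast
  have "jmult x jb \<in> I" using assms(1) x(1) jb_Aconv by (simp add: right_ideal_def)
  then show ?thesis
    unfolding lead_exp_def jmult_jb_right using x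
    by (intro bexI[of _ "jshift 1 x"]) (auto simp: jshift_def)
qed

lemma lead_exp_row:
  assumes "x \<in> I" "\<forall>p q. q < j \<longrightarrow> x p q = 0" "x p j \<noteq> 0"
  obtains k where "k \<le> p" "lead_exp I k j"
proof -
  define k where "k = (LEAST k. x k j \<noteq> 0)"
  have "k \<le> p" unfolding k_def using assms(3) by (rule Least_le)
  have "x k j \<noteq> 0" unfolding k_def using assms(3) by (rule LeastI[of "\<lambda>k. x k j \<noteq> 0"])
  moreover have "\<forall>p<k. x p j = 0"
  proof (intro allI impI)
    fix p assume "p < k"
    then show "x p j = 0" unfolding k_def by (drule_tac not_less_Least) simp
  qed
  ultimately have "lead_exp I k j" unfolding lead_exp_def using assms(1,2) by (intro bexI[of _ x]) auto
  with \<open>k \<le> p\<close> show ?thesis by (rule that)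
qed

text \<open>Used to show that remainders vanish: a nonzero element has, in its lowest power of
  \<open>b\<close>, a leading exponent not exceeding some power of \<open>a\<close> that actually
  occurs.\<close>

lemma lead_exp_exists:
  assumes "x \<in> I" "x p q \<noteq> 0"
  obtains p' q' k where "x p' q' \<noteq> 0" "k \<le> p'" "lead_exp I k q'"
proof -
  define j where "j = (LEAST j. \<exists>p. x p j \<noteq> 0)"
  have "\<exists>p. x p q \<noteq> 0" using assms(2) by blast
  then have "\<exists>p. x p j \<noteq> 0" unfolding j_def by (rule LeastI[of "\<lambda>j. \<exists>p. x p j \<noteq> 0"])
  then obtain p' where p': "x p' j \<noteq> 0" by blast
  have "\<forall>p q. q < j \<longrightarrow> x p q = 0"
  proof (intro allI impI)
    fix p q assume "q < j"
    then show "x p q = 0" unfolding j_def by (drule_tac not_less_Least) simp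
  qed
  then obtain k where "k \<le> p'" "lead_exp I k j" using p' by (rule lead_exp_row[OF assms(1)])
  with p' show ?thesis by (rule that)
qed

text \<open>Write the element with the given leading exponent as \<open>w b^j\<close>, strip
  \<open>b^j\<close> from \<open>x\<close>, and divide by \<open>w\<close>. Twisting the quotient
  \<open>j\<close> times turns \<open>(w u) b^j\<close> into a right multiple of
  \<open>w b^j\<close>, hence an element of the ideal.\<close>

lemma ideal_division:
  assumes I: "right_ideal I" and "lead_exp I k j" and x: "x \<in> Aconv" "\<forall>p q. q < j \<longrightarrow> x p q = 0"
  obtains z where "z \<in> I" "\<forall>p q. q < j \<longrightarrow> z p q = 0" "\<forall>p<k. z p j = 0" "\<forall>p\<ge>k. \<forall>q. z p q = x p q"
proof -
  obtain y where y: "y \<in> I" "\<forall>p q. q < j \<longrightarrow> y p q = 0" "\<forall>p<k. y p j = 0" "y k j \<noteq> 0"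
    using assms(2) unfolding lead_exp_def by blast
  define w where "w = junshift j y"
  have yw: "y = jshift j w" using y(2) by (auto simp: w_def jshift_def junshift_def fun_eq_iff)
  have "y \<in> Aconv" using I y(1) by (auto simp: right_ideal_def add_subgroup_def)
  then have w: "w \<in> Aconv" "\<forall>p<k. w p 0 = 0" "w k 0 \<noteq> 0"
    using y by (auto simp: w_def junshift_Aconv) (auto simp: junshift_def)
  obtain u where u: "u \<in> Aconv" "\<And>p q. jmult w u (p + k) q = junshift j x (p + k) q"
    using weierstrass_division[OF w(1) junshift_Aconv[OF x(1), of j] w(2,3)] by blast
  define z where "z = jmult y ((jtwist ^^ j) u)"
  have z: "z = jshift j (jmult w u)" unfolding z_def yw by (rule jmult_jshift)
  show ?thesis
  proof
    show "z \<in> I" using I y(1) jtwist_funpow_Aconv[OF u(1)] by (simp add: z_def right_ideal_def)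
    show "\<forall>p q. q < j \<longrightarrow> z p q = 0" by (simp add: z jshift_def)
    \<comment> \<open>The part of \<open>w u\<close> free of \<open>b\<close> involves only the
      parts of \<open>w\<close> and \<open>u\<close> free of \<open>b\<close>, and that of
      \<open>w\<close> starts at \<open>a^k\<close>.\<close>
    show "\<forall>p<k. z p j = 0" using w(2) by (simp add: z jshift_def jmult_expand)
    show "\<forall>p\<ge>k. \<forall>q. z p q = x p q"
    proof (intro allI impI)
      fix p q assume "k \<le> p"
      then show "z p q = x p q"
        using u(2)[of "p - k" "q - j"] x(2) by (auto simp: z jshift_def junshift_def)
    qed
  qed
qed

section \<open>Stabilization of leading exponents and the chain condition\<close>

lemma antimono_enat_stable:
  fixes f :: "nat \<Rightarrow> enat"
  assumes "\<And>n. f (Suc n) \<le> f n"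
  obtains N where "\<And>n. n \<ge> N \<Longrightarrow> f n = f N"
proof -
  define v where "v = (LEAST v. v \<in> range f)"
  have "v \<in> range f" unfolding v_def by (rule LeastI[of _ "f 0"]) simp
  then obtain N where N: "v = f N" by blast
  have "f n = f N" if "n \<ge> N" for n
  proof (rule antisym)
    show "f n \<le> f N" by (rule lift_Suc_antimono_le[of f, OF assms that])
    have "v \<le> f n" unfolding v_def by (rule Least_le) simp
    then show "f N \<le> f n" by (simp only: N)
  qed
  then show ?thesis by (rule that)
qed

lemma right_ideal_diff:
  "right_ideal I \<Longrightarrow> x \<in> I \<Longrightarrow> y \<in> I \<Longrightarrow> (\<lambda>p q. x p q - y p q) \<in> I"
  by (simp add: right_ideal_def add_subgroup_def)

lemma right_ideal_add:
  "right_ideal I \<Longrightarrow> x \<in> I \<Longrightarrow> y \<in> I \<Longrightarrow> (\<lambda>p q. x p q + y p q) \<in> I"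
  by (simp add: right_ideal_def add_subgroup_def)

lemma right_ideal_zero: "right_ideal I \<Longrightarrow> (\<lambda>p q. 0) \<in> I"
  by (simp add: right_ideal_def add_subgroup_def)

lemma right_ideal_subset: "right_ideal I \<Longrightarrow> I \<subseteq> Aconv"
  by (simp add: right_ideal_def add_subgroup_def)

text \<open>Elements divisible by \<open>b^j\<close> are treated by descending induction on \<open>j\<close>: beyond the index where
  the least leading exponents become constant one division suffices, below it a division clears
  the coefficient of \<open>b^j\<close>.\<close>
lemma right_ideal_eqI:
  assumes I: "right_ideal I" and I': "right_ideal I'" and sub: "I \<subseteq> I'"
    and lead: "\<And>j. min_lead I' j = min_lead I j"
  shows "I' = I"
proof -
  obtain J where J: "\<And>j. j \<ge> J \<Longrightarrow> min_lead I j = min_lead I J"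
    using antimono_enat_stable[of "min_lead I", OF min_lead_mono[OF lead_exp_Suc[OF I]]] by blast
  \<comment> \<open>The number \<open>i\<close> bounds how far \<open>j\<close> lies below
    \<open>J\<close>; the choice \<open>j = 0\<close>, \<open>i = J\<close> covers all of
    \<open>I'\<close>.\<close>
  have "x \<in> I" if "x \<in> I'" "\<forall>p q. q < j \<longrightarrow> x p q = 0" "J \<le> j + i" for x i j
    using that
  proof (induction i arbitrary: j x)
    case 0
    show ?case
    proof (cases "min_lead I J")
      case infinity
      have "x = (\<lambda>p q. 0)"
      proof (rule ccontr)
        assume "x \<noteq> (\<lambda>p q. 0)"
        then obtain p q where "x p q \<noteq> 0" by (auto simp: fun_eq_iff)
        with 0(1) obtain p' q' k where k: "x p' q' \<noteq> 0" "lead_exp I' k q'"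
          by (rule lead_exp_exists)
        then have "j \<le> q'" using 0(2) by (meson not_le)
        then have "min_lead I' q' = \<infinity>" using J[of q'] 0(3) infinity lead[of q'] by simp
        then show False using min_lead_le[OF k(2)] by simp
      qed
      then show ?thesis using right_ideal_zero[OF I] by simp
    next
      case (enat k)
      then have "lead_exp I k j" using J[of j] 0(3) by (intro min_lead_attained) simp
      moreover have "x \<in> Aconv" using 0(1) right_ideal_subset[OF I'] by blast
      ultimately obtain z where z: "z \<in> I" "\<forall>p q. q < j \<longrightarrow> z p q = 0" "\<forall>p<k. z p j = 0"
          "\<forall>p\<ge>k. \<forall>q. z p q = x p q"
        by (rule ideal_division[OF I _ _ 0(2)])
      define r where "r = (\<lambda>p q. x p q - z p q)"
      have r: "r \<in> I'" unfolding r_def using z(1) sub 0(1) by (intro right_ideal_diff[OF I']) auto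
      \<comment> \<open>The remainder involves only \<open>a^p\<close> with \<open>p < k\<close> and
        powers of \<open>b\<close> from \<open>b^j\<close> on, where the least leading exponent of
        \<open>I'\<close> is \<open>k\<close> throughout.\<close>
      have "r p q = 0" for p q
      proof (rule ccontr)
        assume "r p q \<noteq> 0"
        with r obtain p' q' k' where k': "r p' q' \<noteq> 0" "k' \<le> p'" "lead_exp I' k' q'"
          by (rule lead_exp_exists)
        have "p' < k" using k'(1) z(4) by (force simp: r_def not_less[symmetric])
        have "j \<le> q'" using k'(1) z(2) 0(2) by (force simp: r_def not_less[symmetric])
        then have "min_lead I' q' = enat k" using J[of q'] 0(3) enat lead[of q'] by simp
        then show False using min_lead_le[OF k'(3)] \<open>p' < k\<close> k'(2) by simp
      qed
      then have "x = z" by (auto simp: r_def fun_eq_iff)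
      then show ?thesis using z(1) by simp
    qed
  next
    case (Suc i)
    have IH: "y \<in> I" if "y \<in> I'" "\<forall>p q. q < Suc j \<longrightarrow> y p q = 0" for y
      using Suc.IH[of y "Suc j"] that Suc.prems(3) by simp
    show ?case
    proof (cases "min_lead I j")
      case infinity
      have "x p j = 0" for p
      proof (rule ccontr)
        assume "x p j \<noteq> 0"
        with Suc.prems obtain k where "lead_exp I' k j" by (elim lead_exp_row)
        then show False using min_lead_le[of I' k j] infinity lead[of j] by simp
      qed
      then show ?thesis using Suc.prems by (intro IH) (auto simp: less_Suc_eq)
    next
      case (enat k)
      then have "lead_exp I k j" by (rule min_lead_attained)
      moreover have "x \<in> Aconv" using Suc.prems(1) right_ideal_subset[OF I'] by blast
      ultimately obtain z where z: "z \<in> I" "\<forall>p q. q < j \<longrightarrow> z p q = 0" "\<forall>p<k. z p j = 0"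
          "\<forall>p\<ge>k. \<forall>q. z p q = x p q"
        by (rule ideal_division[OF I _ _ Suc.prems(2)])
      define r where "r = (\<lambda>p q. x p q - z p q)"
      have r: "r \<in> I'" unfolding r_def using z(1) sub Suc.prems(1) by (intro right_ideal_diff[OF I']) auto
      \<comment> \<open>Below \<open>a^k\<close> the coefficients of \<open>b^j\<close> vanish in
        \<open>x\<close> and \<open>z\<close>, and from \<open>a^k\<close> on they agree. So the
        difference starts at \<open>b^(j+1)\<close>.\<close>
      have "x p j = 0" if "p < k" for p
      proof (rule ccontr)
        assume "x p j \<noteq> 0"
        with Suc.prems obtain k' where k': "k' \<le> p" "lead_exp I' k' j" by (elim lead_exp_row)
        then show False using min_lead_le[of I' k' j] enat lead[of j] that by simp
      qed
      then have "r p j = 0" for p using z(3,4) by (cases "p < k") (auto simp: r_def)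
      then have "r \<in> I" using z(2) Suc.prems(2) by (intro IH r) (auto simp: less_Suc_eq r_def)
      then have "(\<lambda>p q. r p q + z p q) \<in> I" using z(1) by (rule right_ideal_add[OF I])
      then show ?thesis by (simp add: r_def)
    qed
  qed
  from this[of _ 0 J] have "I' \<subseteq> I" by auto
  with sub show ?thesis by blast
qed

text \<open>The diagonal stabilizes at some \<open>D\<close>; squeezing between diagonal entries
  makes \<open>M\<close> constant for \<open>n, j \<ge> D\<close>. The finitely many columns
  \<open>j < D\<close> stabilize separately, which gives a bound uniform in
  \<open>j\<close>.\<close>

lemma enat_antimono2_stable:
  fixes M :: "nat \<Rightarrow> nat \<Rightarrow> enat"
  assumes n: "\<And>n j. M (Suc n) j \<le> M n j" and j: "\<And>n j. M n (Suc j) \<le> M n j"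
  obtains N where "\<And>n j. n \<ge> N \<Longrightarrow> M n j = M N j"
proof -
  obtain D where D: "\<And>i. i \<ge> D \<Longrightarrow> M i i = M D D"
    using antimono_enat_stable[of "\<lambda>i. M i i", OF order_trans[OF n j]] by blast
  have mono: "M n' j' \<le> M n j" if "n \<le> n'" "j \<le> j'" for n n' j j'
    using lift_Suc_antimono_le[of "\<lambda>n. M n j", OF n that(1)]
      lift_Suc_antimono_le[of "M n'", OF j that(2)] by (rule order_trans[rotated])
  have const: "M n j = M D D" if "n \<ge> D" "j \<ge> D" for n j
  proof (rule antisym)
    show "M n j \<le> M D D" using that by (rule mono)
    show "M D D \<le> M n j" using D[of "max n j"] that mono[of n "max n j" j "max n j"] by simp
  qed
  have "\<exists>N. \<forall>n\<ge>N. M n j = M N j" for j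
    using antimono_enat_stable[of "\<lambda>n. M n j", OF n] by blast
  then obtain f where f: "\<And>j n. n \<ge> f j \<Longrightarrow> M n j = M (f j) j" by metis
  define N where "N = Max (insert D (f ` {..<D}))"
  have N: "D \<le> N" "\<And>j. j < D \<Longrightarrow> f j \<le> N" by (auto simp: N_def)
  have "M n j = M N j" if "n \<ge> N" for n j
  proof (cases "j < D")
    case True
    then show ?thesis using f[of j n] f[of j N] N(2)[of j] that by simp
  next
    case False
    then show ?thesis using const[of n j] const[of N j] N(1) that by simp
  qed
  then show ?thesis by (rule that)
qed

theorem right_noetherian_Aconv: right_noetherian
  unfolding right_noetherian_def
proof (intro allI impI)
  fix I :: "nat \<Rightarrow> jseries set"
  assume "(\<forall>n. right_ideal (I n)) \<and> (\<forall>n. I n \<subseteq> I (Suc n))"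
  then have I: "\<And>n. right_ideal (I n)" and sub: "\<And>n. I n \<subseteq> I (Suc n)" by auto
  obtain N where N: "\<And>n j. n \<ge> N \<Longrightarrow> min_lead (I n) j = min_lead (I N) j"
  proof -
    have "min_lead (I (Suc n)) j \<le> min_lead (I n) j" for n j
      by (rule min_lead_mono) (rule lead_exp_subset[OF sub])
    moreover have "min_lead (I n) (Suc j) \<le> min_lead (I n) j" for n j
      by (rule min_lead_mono) (rule lead_exp_Suc[OF I])
    ultimately show ?thesis
      using enat_antimono2_stable[of "\<lambda>n j. min_lead (I n) j"] that by blast
  qed
  have "I n = I N" if "n \<ge> N" for n
    using lift_Suc_mono_le[of I, OF sub that] N[OF that] by (intro right_ideal_eqI I)
  then show "\<exists>N. \<forall>n\<ge>N. I n = I N" by blast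
qed

section \<open>Principality of normal right ideals\<close>

lemma normal_right_ideal_lead:
  assumes I: "normal_right_ideal I"
  shows "lead_exp I k j \<Longrightarrow> lead_exp I k 0"
proof (induction j)
  case (Suc j)
  obtain x where x: "x \<in> I" "\<forall>p q. q < Suc j \<longrightarrow> x p q = 0" "\<forall>p<k. x p (Suc j) = 0" "x k (Suc j) \<noteq> 0"
    using Suc.prems unfolding lead_exp_def by blast
  have "x \<in> Aconv" using x(1) I right_ideal_subset by (auto simp: normal_right_ideal_def)
  then have "junshift 1 x \<in> Aconv" by (rule junshift_Aconv)
  \<comment> \<open>As \<open>x\<close> has no term free of \<open>b\<close>, it is a right multiple
    of \<open>b\<close>, and normality cancels that \<open>b\<close>.\<close>
  moreover have "jmult (junshift 1 x) jb = x"
    using x(2) by (auto simp: jmult_jb_right jshift_def junshift_def fun_eq_iff)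
  ultimately have "junshift 1 x \<in> I" using I x(1) by (simp add: normal_right_ideal_def)
  then have "lead_exp I k j" unfolding lead_exp_def using x
    by (intro bexI[of _ "junshift 1 x"]) (auto simp: junshift_def)
  then show ?case by (rule Suc.IH)
qed

text \<open>A generator is an element whose part free of \<open>b\<close> has the least leading
  exponent \<open>k\<close>. Dividing by it leaves a remainder in the ideal of degree below
  \<open>k\<close> in \<open>a\<close>, too small to contain any leading exponent.\<close>

theorem normal_right_ideal_principal:
  assumes "normal_right_ideal I"
  shows "principal_right_ideal I"
proof (cases "\<exists>k. lead_exp I k 0")
  case False
  have I: "right_ideal I" using assms by (simp add: normal_right_ideal_def)
  have zero: "x p q = 0" if "x \<in> I" for x p q
  proof (rule ccontr)
    assume "x p q \<noteq> 0"
    with that obtain p' q' k where "lead_exp I k q'" by (rule lead_exp_exists)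
    then show False using False normal_right_ideal_lead[OF assms] by blast
  qed
  have "I = {\<lambda>p q. 0}"
    using right_ideal_zero[OF I] zero by (auto simp: fun_eq_iff)
  moreover have "(\<lambda>p q. 0) \<in> Aconv" using right_ideal_zero[OF I] right_ideal_subset[OF I] by blast
  moreover have "jmult (\<lambda>p q. 0) x = (\<lambda>p q. 0)" for x
    by (rule symb_inject) (simp add: symb_jmult symb_zero)
  ultimately show ?thesis
    unfolding principal_right_ideal_def by (intro bexI[of _ "\<lambda>p q. 0"]) auto
next
  case True
  have I: "right_ideal I" using assms by (simp add: normal_right_ideal_def)
  define k where "k = (LEAST k. lead_exp I k 0)"
  have k: "lead_exp I k 0" unfolding k_def using True by (rule LeastI_ex)
  \<comment> \<open>Normality brings every leading exponent down to \<open>b^0\<close>, so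
    \<open>k\<close> is minimal for all powers of \<open>b\<close> at once.\<close>
  have k_min: "k \<le> k'" if "lead_exp I k' j" for k' j
    unfolding k_def using normal_right_ideal_lead[OF assms that] by (rule Least_le)
  obtain g where g: "g \<in> I" "\<forall>p<k. g p 0 = 0" "g k 0 \<noteq> 0"
    using k unfolding lead_exp_def by blast
  have gA: "g \<in> Aconv" using g(1) right_ideal_subset[OF I] by blast
  have gI: "jmult g u \<in> I" if "u \<in> Aconv" for u using I g(1) that by (simp add: right_ideal_def)
  have "\<exists>u\<in>Aconv. x = jmult g u" if x: "x \<in> I" for x
  proof -
    have "x \<in> Aconv" using x right_ideal_subset[OF I] by blast
    then obtain u where u: "u \<in> Aconv" "\<And>p q. jmult g u (p + k) q = x (p + k) q"
      using weierstrass_division[OF gA _ g(2,3)] by blast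
    define r where "r = (\<lambda>p q. x p q - jmult g u p q)"
    have r: "r \<in> I" unfolding r_def by (intro right_ideal_diff[OF I] x gI u(1))
    have "r p q = 0" for p q
    proof (rule ccontr)
      assume "r p q \<noteq> 0"
      with r obtain p' q' k' where k': "r p' q' \<noteq> 0" "k' \<le> p'" "lead_exp I k' q'"
        by (rule lead_exp_exists)
      have "k \<le> p'" using k_min[OF k'(3)] k'(2) by simp
      then have "r p' q' = 0" using u(2)[of "p' - k" q'] by (simp add: r_def)
      with k'(1) show False by simp
    qed
    then have "x = jmult g u" by (auto simp: r_def fun_eq_iff)
    with u(1) show ?thesis by blast
  qed
  then have "I = {jmult g x | x. x \<in> Aconv}" using gI by auto
  with gA show ?thesis unfolding principal_right_ideal_def by blast
qed

section \<open>Transfer to left ideals by the anti-automorphism\<close>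

lemma jrev_image_image: "jrev ` jrev ` I = I"
  by (simp add: image_image jrev_jrev)

lemma jrev_image_left_ideal:
  assumes "left_ideal I"
  shows "right_ideal (jrev ` I)"
proof -
  have sub: "I \<subseteq> Aconv" and zero: "(\<lambda>p q. 0) \<in> I"
    and add: "\<And>x y. x \<in> I \<Longrightarrow> y \<in> I \<Longrightarrow> (\<lambda>p q. x p q + y p q) \<in> I"
    and diff: "\<And>x y. x \<in> I \<Longrightarrow> y \<in> I \<Longrightarrow> (\<lambda>p q. x p q - y p q) \<in> I"
    and mult: "\<And>x y. x \<in> Aconv \<Longrightarrow> y \<in> I \<Longrightarrow> jmult x y \<in> I"
    using assms by (auto simp: left_ideal_def add_subgroup_def)
  have "jmult (jrev y) x \<in> jrev ` I" if "x \<in> Aconv" "y \<in> I" for x y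
  proof -
    have "jmult (jrev y) x = jrev (jmult (jrev x) y)" by (simp add: jrev_jmult jrev_jrev)
    then show ?thesis using mult[OF jrev_Aconv[OF that(1)] that(2)] by simp
  qed
  moreover have "(\<lambda>p q. 0) \<in> jrev ` I" using zero jrev_zero by (metis imageI)
  ultimately show ?thesis
    using sub add diff
    by (auto simp: right_ideal_def add_subgroup_def jrev_Aconv subsetD
        simp flip: jrev_add jrev_diff)
qed

theorem left_noetherian_Aconv: left_noetherian
  unfolding left_noetherian_def
proof (intro allI impI)
  fix I :: "nat \<Rightarrow> jseries set"
  assume I: "(\<forall>n. left_ideal (I n)) \<and> (\<forall>n. I n \<subseteq> I (Suc n))"
  have "(\<forall>n. right_ideal (jrev ` I n)) \<and> (\<forall>n. jrev ` I n \<subseteq> jrev ` I (Suc n))"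
    using I by (auto intro: jrev_image_left_ideal)
  then obtain N where "\<forall>n\<ge>N. jrev ` I n = jrev ` I N"
    using right_noetherian_Aconv[unfolded right_noetherian_def, rule_format, of "\<lambda>n. jrev ` I n"] by blast
  then have "\<forall>n\<ge>N. I n = I N" by (metis jrev_image_image)
  then show "\<exists>N. \<forall>n\<ge>N. I n = I N" by blast
qed

theorem normal_left_ideal_principal:
  assumes "normal_left_ideal I"
  shows "principal_left_ideal I"
proof -
  have I: "left_ideal I" and normal: "\<And>x. x \<in> Aconv \<Longrightarrow> jmult jb x \<in> I \<Longrightarrow> x \<in> I"
    using assms by (auto simp: normal_left_ideal_def)
  have "normal_right_ideal (jrev ` I)"
    unfolding normal_right_ideal_def
  proof (intro conjI ballI impI)
    show "right_ideal (jrev ` I)" using I by (rule jrev_image_left_ideal)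
    fix x assume x: "x \<in> Aconv" "jmult x jb \<in> jrev ` I"
    then have "jrev (jmult x jb) \<in> jrev ` jrev ` I" by blast
    then have neg: "(\<lambda>p q. - jmult jb (jrev x) p q) \<in> I"
      by (simp only: jrev_image_image jrev_jmult_jb)
    have zero: "(\<lambda>p q. 0) \<in> I"
      and diff: "\<And>x y. x \<in> I \<Longrightarrow> y \<in> I \<Longrightarrow> (\<lambda>p q. x p q - y p q) \<in> I"
      using I by (simp_all add: left_ideal_def add_subgroup_def)
    \<comment> \<open>The sign coming from \<open>b\<close> going to \<open>-b\<close> is removed by
      subtracting from zero inside the ideal.\<close>
    from diff[OF zero neg] have "(\<lambda>p q. 0 - - jmult jb (jrev x) p q) \<in> I" .
    then have "jmult jb (jrev x) \<in> I" by simp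
    then have "jrev x \<in> I" by (rule normal[OF jrev_Aconv[OF x(1)]])
    then have "jrev (jrev x) \<in> jrev ` I" by (rule imageI)
    then show "x \<in> jrev ` I" by (simp only: jrev_jrev)
  qed
  then obtain g where g: "g \<in> Aconv" "jrev ` I = {jmult g x | x. x \<in> Aconv}"
    using normal_right_ideal_principal unfolding principal_right_ideal_def by blast
  have "I = jrev ` {jmult g x | x. x \<in> Aconv}" by (simp only: g(2)[symmetric] jrev_image_image)
  also have "\<dots> = {jmult x (jrev g) | x. x \<in> Aconv}"
  proof (intro equalityI subsetI)
    fix y assume "y \<in> jrev ` {jmult g x | x. x \<in> Aconv}"
    then obtain x where "x \<in> Aconv" "y = jmult (jrev x) (jrev g)" by (auto simp: jrev_jmult)
    then show "y \<in> {jmult x (jrev g) | x. x \<in> Aconv}" using jrev_Aconv by blast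
  next
    fix y assume "y \<in> {jmult x (jrev g) | x. x \<in> Aconv}"
    then obtain x where "x \<in> Aconv" "y = jrev (jmult g (jrev x))" by (auto simp: jrev_jmult jrev_jrev)
    then show "y \<in> jrev ` {jmult g x | x. x \<in> Aconv}" using jrev_Aconv by blast
  qed
  finally show ?thesis unfolding principal_left_ideal_def using jrev_Aconv[OF g(1)] by blast
qed

theorem theorem1p4p1:
  shows "left_noetherian \<and> right_noetherian
    \<and> (\<forall>I. normal_left_ideal I \<longrightarrow> principal_left_ideal I)
    \<and> (\<forall>I. normal_right_ideal I \<longrightarrow> principal_right_ideal I)"
  using left_noetherian_Aconv right_noetherian_Aconv normal_left_ideal_principal
    normal_right_ideal_principal by blast

end
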